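(* Let $\Sigma=(A,B,C,D)$ (state dimension $n$) and $\tilde\Sigma=(\tilde A,\tilde B,\tilde C,\tilde D)$ (state dimension $r$) be two real linear time-invariant systems, both with $m$ inputs and $m$ outputs, that are passive, minimal and asymptotically stable, with transfer functions $G$ and $\tilde G$, respectively. Let $H(s)=M+L(sI_n-A)^{-1}B$ and $\tilde H(s)=\tilde M+\tilde L(sI_r-\tilde A)^{-1}\tilde B$ be the transfer functions of spectral factors $(A,B,L,M)$ of $\Sigma$ and $(\tilde A,\tilde B,\tilde L,\tilde M)$ of $\tilde\Sigma$, respectively, where $H$ and $\tilde H$ have the same number $k$ of rows. If $G-\tilde G\in\mathcal H_2(\mathbb C_+)$ and $H-\tilde H\in\mathcal H_2(\mathbb C_+)$, then $$\|G-\tilde G\|_{\mathcal H_2(\mathbb C_+)}\le c(H,\tilde H)\,\|H-\tilde H\|_{\mathcal H_2(\mathbb C_+)},$$ where $$c(H,\tilde H):=\frac1{\sqrt2}\Big(\|H^\top(-\,\cdot)\|_{L^\infty(\imath\mathbb R)}+\|\tilde H(\cdot)\|_{L^\infty(\imath\mathbb R)}\Big).$$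
   Context: A system $(A,B,C,D)$ with $A\in\mathbb R^{n\times n}$, $B\in\mathbb R^{n\times m}$, $C\in\mathbb R^{p\times n}$, $D\in\mathbb R^{p\times m}$ means $\dot x=Ax+Bu$, $y=Cx+Du$; its transfer function is $C(sI_n-A)^{-1}B+D$. It is minimal if $\operatorname{rank}[sI_n-A,\ B]=n=\operatorname{rank}[sI_n-A^\top,\ C^\top]$ for all $s\in\mathbb C$, and asymptotically stable if all eigenvalues of $A$ have negative real part. For $p=m$, the system is passive if there is a function $\mathcal H:\mathbb R^n\to[0,\infty)$ (storage function) such that $\mathcal H(x(t_1))-\mathcal H(x(t_0))\le\int_{t_0}^{t_1}y(\tau)^\top u(\tau)\,d\tau$ for all $t_1\ge t_0$ and all trajectories $(u,x,y)$ of the system. For $X=X^\top\in\mathbb R^{n\times n}$ put $$\mathcal W(X)=\begin{bmatrix}-A^\top X-XA & C^\top-XB\\ C-B^\top X & D+D^\top\end{bmatrix}.$$ The KYP inequality is $\mathcal W(X)\ge0$ (positive semidefinite). A spectral factor of a passive system $(A,B,C,D)$ is a system $(A,B,L,M)$ with $L\in\mathbb R^{k\times n}$, $M\in\mathbb R^{k\times m}$ such that, for some symmetric positive semidefinite $X\in\mathbb R^{n\times n}$ with $\mathcal W(X)\ge 0$, $$\mathcal W(X)=\begin{bmatrix}L^\top\\ M^\top\end{bmatrix}\begin{bmatrix}L& M\end{bmatrix}.$$ Spectral factors of $\tilde\Sigma$ are defined in the same way with the matrices of $\tilde\Sigma$. $\mathbb C_+$ is the open right half plane. $\mathcal H_2(\mathbb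 C_+)$ is the space of matrix-valued analytic functions $F$ on $\mathbb C_+$ with finite norm $\|F\|_{\mathcal H_2(\mathbb C_+)}=\big(\sup_{\sigma>0}\int_{-\infty}^\infty\|F(\sigma+\imath\omega)\|_{\mathrm F}^2\,d\omega\big)^{1/2}$, where $\|\cdot\|_{\mathrm F}$ is the Frobenius norm. $\|F\|_{L^\infty(\imath\mathbb R)}=\operatorname{ess\,sup}_{\omega\in\mathbb R}\|F(\imath\omega)\|_2$ with the spectral norm $\|\cdot\|_2$. $H^\top(-\,\cdot)$ denotes $s\mapsto H(-s)^\top$. *)

theory Defs
  imports "HOL-Complex_Analysis.Complex_Analysis" "HOL-Probability.Essential_Supremum"
begin

section \<open>Matrices\<close>

definition cmat :: "real^'b^'a \<Rightarrow> complex^'b^'a" where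
  "cmat M = (\<chi> i j. complex_of_real (M $ i $ j))"

definition hcat :: "'e^'b^'a \<Rightarrow> 'e^'c^'a \<Rightarrow> 'e^('b + 'c)^'a" where
  "hcat P Q = (\<chi> i j. case j of Inl k \<Rightarrow> P $ i $ k | Inr k \<Rightarrow> Q $ i $ k)"

definition vcat :: "'e^'c^'a \<Rightarrow> 'e^'c^'b \<Rightarrow> 'e^'c^('a + 'b)" where
  "vcat P Q = (\<chi> i. case i of Inl k \<Rightarrow> P $ k | Inr k \<Rightarrow> Q $ k)"

definition pos_semidef :: "real^'a^'a \<Rightarrow> bool" where
  "pos_semidef M \<longleftrightarrow> transpose M = M \<and> (\<forall>v. 0 \<le> v \<bullet> (M *v v))"

definition eigenvalue :: "complex^'a^'a \<Rightarrow> complex \<Rightarrow> bool" where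
  "eigenvalue M l \<longleftrightarrow> (\<exists>v. v \<noteq> 0 \<and> M *v v = l *s v)"

section \<open>Linear time-invariant systems\<close>

text \<open>Here \<^term>\<open>mat s\<close> is \<open>s I\<close>. At an eigenvalue \<open>s\<close> of \<open>A\<close> the value is unspecified.\<close>

definition transfer ::
    "real^'n^'n \<Rightarrow> real^'m^'n \<Rightarrow> real^'n^'p \<Rightarrow> real^'m^'p \<Rightarrow> complex \<Rightarrow> complex^'m^'p" where
  "transfer A B C D s = cmat C ** matrix_inv (mat s - cmat A) ** cmat B + cmat D"

definition minimal_system ::
    "real^'n^'n \<Rightarrow> real^'m^'n \<Rightarrow> real^'n^'p \<Rightarrow> real^'m^'p \<Rightarrow> bool" where
  "minimal_system A B C D \<longleftrightarrow>
     (\<forall>s::complex. rank (hcat (mat s - cmat A) (cmat B)) = CARD('n) \<and>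
                   rank (hcat (mat s - cmat (transpose A)) (cmat (transpose C))) = CARD('n))"

definition asymptotically_stable :: "real^'n^'n \<Rightarrow> bool" where
  "asymptotically_stable A \<longleftrightarrow> (\<forall>l. eigenvalue (cmat A) l \<longrightarrow> Re l < 0)"

text \<open>Trajectories are classical solutions on the whole time axis with continuous input.\<close>

definition trajectory ::
    "real^'n^'n \<Rightarrow> real^'m^'n \<Rightarrow> real^'n^'p \<Rightarrow> real^'m^'p \<Rightarrow>
     (real \<Rightarrow> real^'m) \<Rightarrow> (real \<Rightarrow> real^'n) \<Rightarrow> (real \<Rightarrow> real^'p) \<Rightarrow> bool" where
  "trajectory A B C D u x y \<longleftrightarrow>
     continuous_on UNIV u \<and>
     (\<forall>t. (x has_vector_derivative (A *v x t + B *v u t)) (at t)) \<and>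
     (\<forall>t. y t = C *v x t + D *v u t)"

definition passive_system ::
    "real^'n^'n \<Rightarrow> real^'m^'n \<Rightarrow> real^'n^'m \<Rightarrow> real^'m^'m \<Rightarrow> bool" where
  "passive_system A B C D \<longleftrightarrow>
     (\<exists>S :: real^'n \<Rightarrow> real. (\<forall>z. 0 \<le> S z) \<and>
        (\<forall>u x y t0 t1. trajectory A B C D u x y \<and> t0 \<le> t1 \<longrightarrow>
           S (x t1) - S (x t0) \<le> integral {t0..t1} (\<lambda>\<tau>. y \<tau> \<bullet> u \<tau>)))"

definition KYP_matrix ::
    "real^'n^'n \<Rightarrow> real^'m^'n \<Rightarrow> real^'n^'m \<Rightarrow> real^'m^'m \<Rightarrow> real^'n^'n \<Rightarrow>
     real^('n + 'm)^('n + 'm)" where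
  "KYP_matrix A B C D X =
     vcat (hcat (- (transpose A ** X) - X ** A) (transpose C - X ** B))
          (hcat (C - transpose B ** X)          (D + transpose D))"

definition spectral_factor ::
    "real^'n^'n \<Rightarrow> real^'m^'n \<Rightarrow> real^'n^'m \<Rightarrow> real^'m^'m \<Rightarrow>
     real^'n^'k \<Rightarrow> real^'m^'k \<Rightarrow> bool" where
  "spectral_factor A B C D L M \<longleftrightarrow>
     (\<exists>X. pos_semidef X \<and> pos_semidef (KYP_matrix A B C D X) \<and>
          KYP_matrix A B C D X = vcat (transpose L) (transpose M) ** hcat L M)"

section \<open>Function spaces\<close>

text \<open>The library norm on \<^typ>\<open>complex^'b^'a\<close> is the Frobenius norm.\<close>

lemma norm_matrix_eq_frobenius:
  fixes M :: "complex^'b^'a"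
  shows "(norm M)\<^sup>2 = (\<Sum>i\<in>UNIV. \<Sum>j\<in>UNIV. (cmod (M $ i $ j))\<^sup>2)"
  by (simp add: norm_vec_def L2_set_def sum_nonneg)

definition H2_norm_sq :: "(complex \<Rightarrow> complex^'b^'a) \<Rightarrow> ennreal" where
  "H2_norm_sq F =
     (SUP \<sigma>\<in>{0<..}. \<integral>\<^sup>+ \<omega>. ennreal ((norm (F (Complex \<sigma> \<omega>)))\<^sup>2) \<partial>lborel)"

definition hardy_H2 :: "(complex \<Rightarrow> complex^'b^'a) set" where
  "hardy_H2 = {F. (\<forall>i j. (\<lambda>s. F s $ i $ j) analytic_on {s. 0 < Re s}) \<and> H2_norm_sq F < \<infinity>}"

text \<open>This is the \<open>H\<^sub>2\<close> norm only on \<^term>\<open>hardy_H2\<close>; \<^const>\<open>enn2real\<close> maps \<open>\<infinity>\<close> to \<open>0\<close>.\<close>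

definition H2_norm :: "(complex \<Rightarrow> complex^'b^'a) \<Rightarrow> real" where
  "H2_norm F = sqrt (enn2real (H2_norm_sq F))"

definition spectral_norm :: "complex^'b^'a \<Rightarrow> real" where
  "spectral_norm M = onorm ((*v) M)"

definition Linf_imag_norm :: "(complex \<Rightarrow> complex^'b^'a) \<Rightarrow> ereal" where
  "Linf_imag_norm F = esssup lborel (\<lambda>\<omega>. ereal (spectral_norm (F (Complex 0 \<omega>))))"

definition factor_const ::
    "(complex \<Rightarrow> complex^'m^'k) \<Rightarrow> (complex \<Rightarrow> complex^'m^'k) \<Rightarrow> ereal" where
  "factor_const H H' =
     ereal (1 / sqrt 2) * (Linf_imag_norm (\<lambda>s. transpose (H (- s))) + Linf_imag_norm H')"

end

theory Submission
  imports Defs "HOL-Probability.Sinc_Integral"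
begin

text \<open>
  The KYP factorization gives \<open>G(s) + G(-s)\<^sup>T = H(-s)\<^sup>T H(s)\<close>. With \<open>E = G - G'\<close> and \<open>\<Delta> = H - H'\<close>, on the
  imaginary axis \<open>E + E\<^sup>* = H\<^sup>* \<Delta> + \<Delta>\<^sup>* H'\<close>, whose Frobenius norm is at most
  \<open>(\<parallel>H\<^sup>*\<parallel>\<^sub>\<infinity> + \<parallel>H'\<parallel>\<^sub>\<infinity>) \<parallel>\<Delta>\<parallel>\<close>. As \<open>E\<close> is stable and decays, \<open>tr (E\<^sup>2)\<close> integrates to zero along the
  axis (shift the line to the right), so \<open>\<parallel>E + E\<^sup>*\<parallel>\<^sup>2 = 2 \<parallel>E\<parallel>\<^sup>2\<close> in \<open>L\<^sup>2\<close>.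
  Fatou's lemma bounds the \<open>L\<^sup>2\<close> norm of \<open>\<Delta>\<close> on the axis by its \<open>H\<^sub>2\<close> norm. For the opposite bound for \<open>E\<close>,
  the squared norm \<open>N(\<sigma>)\<close> on the line \<open>Re s = \<sigma>\<close> satisfies \<open>N(\<sigma>) \<le> (N(0) + N(2 \<sigma>)) / 2\<close>; as \<open>N\<close> is
  bounded, iterating gives \<open>N(\<sigma>) \<le> N(0)\<close>.
\<close>

section \<open>Scalar functions analytic beyond the closed right half plane\<close>

lemma integrable_cauchy_kernel: "integrable lborel (\<lambda>x::real. K / (1 + x\<^sup>2))"
proof -
  have "integrable lborel (\<lambda>x::real. inverse (1 + x\<^sup>2))"
    using integrable_inverse_1_plus_square by (simp add: set_integrable_def)
  then have "integrable lborel (\<lambda>x::real. K * inverse (1 + x\<^sup>2))"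
    by (rule integrable_mult_right)
  then show ?thesis by (simp add: field_simps)
qed

lemma integrable_line:
  fixes f :: "complex \<Rightarrow> complex"
  assumes "continuous_on {s. Re s = \<sigma>} f"
    and "\<And>\<omega>. cmod (f (Complex \<sigma> \<omega>)) \<le> K / (1 + \<omega>\<^sup>2)"
  shows "integrable lborel (\<lambda>\<omega>. f (Complex \<sigma> \<omega>))"
proof (rule Bochner_Integration.integrable_bound[OF integrable_cauchy_kernel[of K]])
  have "continuous_on UNIV (\<lambda>\<omega>. f (Complex \<sigma> \<omega>))"
    by (rule continuous_on_compose2[OF assms(1)])
       (auto intro!: continuous_intros simp: Complex_eq)
  then show "(\<lambda>\<omega>. f (Complex \<sigma> \<omega>)) \<in> borel_measurable lborel"
    by (simp add: borel_measurable_continuous_onI)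
  show "AE \<omega> in lborel. norm (f (Complex \<sigma> \<omega>)) \<le> norm (K / (1 + \<omega>\<^sup>2))"
    by (auto intro!: AE_I2 order_trans[OF assms(2)] divide_right_mono)
qed

text \<open>In place of a rectangular contour, a primitive \<open>g\<close> on the convex strip is
  used: the difference of \<open>g\<close> on the two lines has as derivative \<open>\<i>\<close>
  times the difference of the integrands and vanishes at both ends, so the fundamental theorem of
  calculus gives equal integrals.\<close>

lemma line_integral_shift:
  fixes f :: "complex \<Rightarrow> complex"
  assumes holo: "f holomorphic_on {s. a < Re s \<and> Re s < b}"
    and bnd: "\<And>s. a < Re s \<Longrightarrow> Re s < b \<Longrightarrow> cmod (f s) \<le> K / (1 + (Im s)\<^sup>2)"
    and \<sigma>: "a < \<sigma>" "\<sigma> < b" and \<tau>: "a < \<tau>" "\<tau> < b"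
  shows "(\<integral>\<omega>. f (Complex \<sigma> \<omega>) \<partial>lborel) = (\<integral>\<omega>. f (Complex \<tau> \<omega>) \<partial>lborel)"
proof -
  let ?S = "{s. a < Re s \<and> Re s < b}"
  have S: "?S = {s. Re s > a} \<inter> {s. Re s < b}" by auto
  have conv: "convex ?S"
    unfolding S by (intro convex_Int convex_halfspace_Re_gt convex_halfspace_Re_lt)
  have op: "open ?S"
    unfolding S by (intro open_Int open_halfspace_Re_gt open_halfspace_Re_lt)
  obtain g where g0: "\<And>x. x \<in> ?S \<Longrightarrow> (g has_field_derivative f x) (at x within ?S)"
    using holomorphic_convex_primitive'[OF conv op holo] by blast
  have g: "(g has_field_derivative f x) (at x)" if "x \<in> ?S" for x
    using g0[OF that] unfolding at_within_open[OF that op] .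
  have cf: "continuous_on ?S f" using holo by (rule holomorphic_on_imp_continuous_on)
  have line: "continuous_on UNIV (\<lambda>\<omega>. f (Complex \<rho> \<omega>))"
    "integrable lborel (\<lambda>\<omega>. f (Complex \<rho> \<omega>))"
    "\<And>\<omega>. ((\<lambda>\<omega>. g (Complex \<rho> \<omega>)) has_vector_derivative \<i> * f (Complex \<rho> \<omega>)) (at \<omega>)"
    if \<rho>: "a < \<rho>" "\<rho> < b" for \<rho>
  proof -
    show "continuous_on UNIV (\<lambda>\<omega>. f (Complex \<rho> \<omega>))"
      by (rule continuous_on_compose2[OF cf])
         (use \<rho> in \<open>auto intro!: continuous_intros simp: Complex_eq\<close>)
    show "integrable lborel (\<lambda>\<omega>. f (Complex \<rho> \<omega>))"
      by (rule integrable_line[where K = K])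
         (use \<rho> in \<open>auto intro!: continuous_on_subset[OF cf] order_trans[OF bnd]\<close>)
    fix \<omega>
    have "((\<lambda>\<omega>. Complex \<rho> \<omega>) has_vector_derivative \<i>) (at \<omega>)"
      unfolding Complex_eq by (auto intro!: derivative_eq_intros simp: has_vector_derivative_def fun_eq_iff scaleR_conv_of_real)
    from field_vector_diff_chain_at[OF this g[of "Complex \<rho> \<omega>"]]
    show "((\<lambda>\<omega>. g (Complex \<rho> \<omega>)) has_vector_derivative \<i> * f (Complex \<rho> \<omega>)) (at \<omega>)"
      using \<rho> by (simp add: o_def)
  qed
  define h where "h = (\<lambda>\<omega>. g (Complex \<sigma> \<omega>) - g (Complex \<tau> \<omega>))"
  define h' where "h' = (\<lambda>\<omega>. \<i> * (f (Complex \<sigma> \<omega>) - f (Complex \<tau> \<omega>)))"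
  have hd: "(h has_vector_derivative h' \<omega>) (at \<omega>)" for \<omega>
    unfolding h_def h'_def
    by (rule has_vector_derivative_eq_rhs[OF has_vector_derivative_diff[OF line(3)[OF \<sigma>] line(3)[OF \<tau>]]])
       (simp add: algebra_simps)
  have hc: "continuous_on UNIV h'"
    unfolding h'_def by (intro continuous_intros line(1) \<sigma> \<tau>)
  have hi: "integrable lborel h'"
    unfolding h'_def by (intro integrable_mult_right Bochner_Integration.integrable_diff line(2) \<sigma> \<tau>)
  \<comment> \<open>On the horizontal segment at height \<open>\<omega>\<close> the bound on
    \<open>f\<close> is constant, and the segment has length
    \<open>\<bar>\<sigma> - \<tau>\<bar>\<close>.\<close>
  have hb: "norm (h \<omega>) \<le> K / (1 + \<omega>\<^sup>2) * \<bar>\<sigma> - \<tau>\<bar>" for \<omega>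
  proof -
    let ?T = "{s. a < Re s \<and> Re s < b \<and> Im s = \<omega>}"
    have T: "?T = ?S \<inter> {s. Im s \<le> \<omega>} \<inter> {s. Im s \<ge> \<omega>}" by auto
    have "convex ?T"
      unfolding T by (intro convex_Int conv convex_halfspace_Im_le convex_halfspace_Im_ge)
    moreover have "(g has_field_derivative f z) (at z within ?T)" if "z \<in> ?T" for z
      using g[of z] that by (auto intro: has_field_derivative_at_within)
    moreover have "norm (f z) \<le> K / (1 + \<omega>\<^sup>2)" if "z \<in> ?T" for z
      using bnd[of z] that by auto
    ultimately have "norm (g (Complex \<sigma> \<omega>) - g (Complex \<tau> \<omega>))
        \<le> K / (1 + \<omega>\<^sup>2) * norm (Complex \<sigma> \<omega> - Complex \<tau> \<omega>)"
      by (rule field_differentiable_bound) (use \<sigma> \<tau> in auto)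
    then show ?thesis by (simp add: h_def cmod_def)
  qed
  \<comment> \<open>A general filter \<open>F\<close> covers both ends of the line at once.\<close>
  have lim: "(h \<longlongrightarrow> 0) F" if "filterlim (\<lambda>\<omega>::real. \<omega>\<^sup>2) at_top F" for F
  proof (rule Lim_null_comparison[OF always_eventually, OF allI, OF hb])
    have "filterlim (\<lambda>\<omega>::real. 1 + \<omega>\<^sup>2) at_top F"
      by (rule filterlim_tendsto_add_at_top[OF tendsto_const that])
    from tendsto_divide_0[OF tendsto_const filterlim_at_top_imp_at_infinity[OF this], of K]
    show "((\<lambda>\<omega>. K / (1 + \<omega>\<^sup>2) * \<bar>\<sigma> - \<tau>\<bar>) \<longlongrightarrow> 0) F"
      by (rule tendsto_mult_left_zero)
  qed
  have l1: "(h \<longlongrightarrow> 0) at_top"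
    by (rule lim) real_asymp
  have l2: "(h \<longlongrightarrow> 0) at_bot"
    by (rule lim) real_asymp
  have "(LBINT x=-\<infinity>..\<infinity>. h' x) = 0 - 0"
  proof (rule interval_integral_FTC_integrable[where F = h])
    show "isCont h' x" for x using hc by (simp add: continuous_on_eq_continuous_at)
    show "set_integrable lborel (einterval (- \<infinity>) \<infinity>) h'"
      using hi by (simp add: set_integrable_def)
    show "((h \<circ> real_of_ereal) \<longlongrightarrow> 0) (at_right (- \<infinity>))" "((h \<circ> real_of_ereal) \<longlongrightarrow> 0) (at_left \<infinity>)"
      using l1 l2 by (simp_all add: ereal_tendsto_simps1)
  qed (auto intro: hd)
  then have "(\<integral>x. h' x \<partial>lborel) = 0"
    by (simp add: interval_lebesgue_integral_def set_lebesgue_integral_def)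
  then show ?thesis
    unfolding h'_def by (simp add: line(2) \<sigma> \<tau>)
qed

text \<open>Tailored to the entries of strictly proper stable transfer functions. The half plane
  reaches strictly past the imaginary axis, so that the axis is interior and lines can be shifted
  onto it. First-order decay suffices because only products of two such functions are
  integrated.\<close>

definition stable_decay :: "(complex \<Rightarrow> complex) \<Rightarrow> bool" where
  "stable_decay e \<longleftrightarrow> (\<exists>\<epsilon>>0. \<exists>K. e holomorphic_on {s. - \<epsilon> < Re s} \<and>
     (\<forall>s. - \<epsilon> < Re s \<longrightarrow> cmod (e s) \<le> K / (1 + cmod s)))"

section \<open>Closure of stable decay under linear combinations\<close>

lemma stable_decay_add:
  assumes "stable_decay e" "stable_decay f"
  shows "stable_decay (\<lambda>s. e s + f s)"
proof -
  obtain \<epsilon> K where e: "\<epsilon> > 0" "e holomorphic_on {s. - \<epsilon> < Re s}"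
    "\<And>s. - \<epsilon> < Re s \<Longrightarrow> cmod (e s) \<le> K / (1 + cmod s)"
    using assms(1) unfolding stable_decay_def by blast
  obtain \<delta> J where f: "\<delta> > 0" "f holomorphic_on {s. - \<delta> < Re s}"
    "\<And>s. - \<delta> < Re s \<Longrightarrow> cmod (f s) \<le> J / (1 + cmod s)"
    using assms(2) unfolding stable_decay_def by blast
  have "(\<lambda>s. e s + f s) holomorphic_on {s. - min \<epsilon> \<delta> < Re s}"
    by (intro holomorphic_intros holomorphic_on_subset[OF e(2)] holomorphic_on_subset[OF f(2)]) auto
  moreover have "cmod (e s + f s) \<le> (K + J) / (1 + cmod s)" if "- min \<epsilon> \<delta> < Re s" for s
  proof -
    have "- \<epsilon> < Re s" "- \<delta> < Re s" using that by linarith+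
    from e(3)[OF this(1)] f(3)[OF this(2)] show ?thesis
      unfolding add_divide_distrib by (rule norm_triangle_le[OF add_mono])
  qed
  ultimately show ?thesis
    unfolding stable_decay_def using e(1) f(1) by (intro exI[of _ "min \<epsilon> \<delta>"] conjI exI[of _ "K + J"]) auto
qed

lemma stable_decay_cmult:
  assumes "stable_decay e"
  shows "stable_decay (\<lambda>s. c * e s)"
proof -
  obtain \<epsilon> K where e: "\<epsilon> > 0" "e holomorphic_on {s. - \<epsilon> < Re s}"
    "\<And>s. - \<epsilon> < Re s \<Longrightarrow> cmod (e s) \<le> K / (1 + cmod s)"
    using assms(1) unfolding stable_decay_def by blast
  have "cmod (c * e s) \<le> (cmod c * K) / (1 + cmod s)" if "- \<epsilon> < Re s" for s
    using mult_left_mono[OF e(3)[OF that], of "cmod c"] by (simp add: norm_mult)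
  then show ?thesis
    unfolding stable_decay_def
    using e(1,2) by (intro exI[of _ \<epsilon>] conjI exI[of _ "cmod c * K"]) (auto intro!: holomorphic_intros)
qed

lemma stable_decay_diff:
  "stable_decay e \<Longrightarrow> stable_decay f \<Longrightarrow> stable_decay (\<lambda>s. e s - f s)"
  using stable_decay_add[of e "\<lambda>s. - 1 * f s"] stable_decay_cmult[of f "-1"] by simp

lemma stable_decay_sum:
  assumes "finite I" "\<And>i. i \<in> I \<Longrightarrow> stable_decay (e i)"
  shows "stable_decay (\<lambda>s. \<Sum>i\<in>I. e i s)"
  using assms
proof (induction I)
  case empty
  have "stable_decay (\<lambda>s. 0)"
    unfolding stable_decay_def by (intro exI[of _ 1] conjI exI[of _ 0]) auto
  then show ?case by simp
qed (simp add: stable_decay_add)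

text \<open>Two first-order decays multiply to the integrable kernel. The points \<open>s\<close>
  and \<open>t\<close> share only their imaginary part, because the reflection argument evaluates at
  mirror images in a vertical line.\<close>

lemma decay_mult:
  assumes "x \<le> K / (1 + cmod s)" "y \<le> J / (1 + cmod t)" "0 \<le> x" "0 \<le> y"
    "Im s = \<omega>" "Im t = \<omega>"
  shows "x * y \<le> K * J / (1 + \<omega>\<^sup>2)"
proof -
  have "0 < 1 + cmod s" "0 < 1 + cmod t" by (simp_all add: add_pos_nonneg)
  then have K: "0 \<le> K" and J: "0 \<le> J"
    using order_trans[OF assms(3,1)] order_trans[OF assms(4,2)]
    by (simp_all add: pos_le_divide_eq)
  have "1 + \<omega>\<^sup>2 \<le> (1 + \<bar>\<omega>\<bar>) * (1 + \<bar>\<omega>\<bar>)" by (simp add: algebra_simps power2_eq_square)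
  also have "\<dots> \<le> (1 + cmod s) * (1 + cmod t)"
    using abs_Im_le_cmod[of s] abs_Im_le_cmod[of t] assms by (intro mult_mono) auto
  finally have le: "1 + \<omega>\<^sup>2 \<le> (1 + cmod s) * (1 + cmod t)" .
  have "x * y \<le> (K / (1 + cmod s)) * (J / (1 + cmod t))"
    using assms K by (intro mult_mono) auto
  also have "\<dots> = K * J / ((1 + cmod s) * (1 + cmod t))" by simp
  also have "\<dots> \<le> K * J / (1 + \<omega>\<^sup>2)"
    using le K J by (intro divide_left_mono mult_pos_pos) (auto simp: add_pos_nonneg)
  finally show ?thesis .
qed

section \<open>Square integrals along vertical lines\<close>

lemma stable_decay_continuous_on:
  assumes "stable_decay e"
  shows "continuous_on {s. 0 \<le> Re s} e"
proof -
  obtain \<epsilon> where "\<epsilon> > 0" "e holomorphic_on {s. - \<epsilon> < Re s}"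
    using assms unfolding stable_decay_def by blast
  then show ?thesis
    by (auto intro!: continuous_on_subset[OF holomorphic_on_imp_continuous_on])
qed

lemma continuous_on_line:
  fixes F :: "complex \<Rightarrow> 'b::topological_space"
  assumes "continuous_on {s. 0 \<le> Re s} F" "0 \<le> \<sigma>"
  shows "continuous_on UNIV (\<lambda>\<omega>. F (Complex \<sigma> \<omega>))"
  by (rule continuous_on_compose2[OF assms(1)])
     (use assms(2) in \<open>auto intro!: continuous_intros simp: Complex_eq\<close>)

text \<open>The squared modulus lies below \<open>K * K / (1 + \<omega>\<^sup>2)\<close> on each
  line. That one \<open>N\<close> serves all lines is what later makes the doubling iteration
  converge.\<close>

lemma stable_decay_integrable_sq:
  assumes "stable_decay e"
  shows "\<exists>N. \<forall>\<sigma>\<ge>0. integrable lborel (\<lambda>\<omega>. (cmod (e (Complex \<sigma> \<omega>)))\<^sup>2) \<and>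
            (\<integral>\<omega>. (cmod (e (Complex \<sigma> \<omega>)))\<^sup>2 \<partial>lborel) \<le> N"
proof -
  obtain \<epsilon> K where e: "\<epsilon> > 0" "\<And>s. - \<epsilon> < Re s \<Longrightarrow> cmod (e s) \<le> K / (1 + cmod s)"
    using assms unfolding stable_decay_def by blast
  have b: "(cmod (e (Complex \<sigma> \<omega>)))\<^sup>2 \<le> K * K / (1 + \<omega>\<^sup>2)" if "\<sigma> \<ge> 0" for \<sigma> \<omega>
    unfolding power2_eq_square[of "cmod _"]
    by (rule decay_mult[OF e(2) e(2)]) (use e(1) that in auto)
  have i: "integrable lborel (\<lambda>\<omega>. (cmod (e (Complex \<sigma> \<omega>)))\<^sup>2)" if "\<sigma> \<ge> 0" for \<sigma>
  proof (rule Bochner_Integration.integrable_bound[OF integrable_cauchy_kernel[of "K * K"]])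
    have "continuous_on UNIV (\<lambda>\<omega>. (cmod (e (Complex \<sigma> \<omega>)))\<^sup>2)"
      by (intro continuous_intros continuous_on_line stable_decay_continuous_on assms that)
    then show "(\<lambda>\<omega>. (cmod (e (Complex \<sigma> \<omega>)))\<^sup>2) \<in> borel_measurable lborel"
      by (simp add: borel_measurable_continuous_onI)
    show "AE \<omega> in lborel. norm ((cmod (e (Complex \<sigma> \<omega>)))\<^sup>2) \<le> norm (K * K / (1 + \<omega>\<^sup>2))"
      using b[OF that] by (auto intro!: AE_I2)
  qed
  show ?thesis
    by (rule exI[of _ "\<integral>\<omega>. K * K / (1 + \<omega>\<^sup>2) \<partial>lborel"])
       (use i b integrable_cauchy_kernel in \<open>auto intro!: integral_mono\<close>)
qed

text \<open>Integrate \<open>e(s) \<cdot> cnj (e(2 \<sigma> - cnj s))\<close>, which is analytic in the strip: on the line through \<open>\<sigma>\<close>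
  it is \<open>\<bar>e\<bar>\<^sup>2\<close>, and on the imaginary axis it pairs the values of \<open>e\<close> on the lines through \<open>0\<close> and \<open>2 \<sigma>\<close>.\<close>

lemma stable_decay_line_norm_mid:
  assumes "stable_decay e" "0 < \<sigma>"
  defines "N \<equiv> \<lambda>\<rho>. \<integral>\<omega>. (cmod (e (Complex \<rho> \<omega>)))\<^sup>2 \<partial>lborel"
  shows "N \<sigma> \<le> (N 0 + N (2 * \<sigma>)) / 2"
proof -
  obtain \<epsilon> K where e: "\<epsilon> > 0" "e holomorphic_on {s. - \<epsilon> < Re s}"
    "\<And>s. - \<epsilon> < Re s \<Longrightarrow> cmod (e s) \<le> K / (1 + cmod s)"
    using assms unfolding stable_decay_def by blast
  define f where "f = (\<lambda>s. e s * cnj (e (2 * \<sigma> - cnj s)))"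
  have "cnj ` {s. - \<epsilon> < Re s} = {s. - \<epsilon> < Re s}"
    by (force intro!: image_eqI[where x = "cnj _"])
  then have "cnj \<circ> e \<circ> cnj holomorphic_on {s. - \<epsilon> < Re s}"
    by (intro holomorphic_on_compose_cnj_cnj) (auto simp: e(2) open_halfspace_Re_gt)
  \<comment> \<open>This composition is \<open>cnj (e (2 * \<sigma> - cnj s))\<close>; the point
    \<open>2 * \<sigma> - s\<close> stays in the domain of \<open>e\<close> exactly when
    \<open>Re s < 2 * \<sigma> + \<epsilon>\<close>.\<close>
  then have "(cnj \<circ> e \<circ> cnj) \<circ> (\<lambda>s. 2 * \<sigma> - s) holomorphic_on {s. - \<epsilon> < Re s \<and> Re s < 2 * \<sigma> + \<epsilon>}"
    by (rule holomorphic_on_compose_gen[rotated]) (auto intro!: holomorphic_intros)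
  then have "f holomorphic_on {s. - \<epsilon> < Re s \<and> Re s < 2 * \<sigma> + \<epsilon>}"
    unfolding f_def o_def
    by (intro holomorphic_intros holomorphic_on_subset[OF e(2)]) auto
  moreover have "cmod (f s) \<le> K * K / (1 + (Im s)\<^sup>2)" if "- \<epsilon> < Re s" "Re s < 2 * \<sigma> + \<epsilon>" for s
    unfolding f_def norm_mult complex_mod_cnj
    by (rule decay_mult[OF e(3) e(3)]) (use that in auto)
  ultimately have "(\<integral>\<omega>. f (Complex \<sigma> \<omega>) \<partial>lborel) = (\<integral>\<omega>. f (Complex 0 \<omega>) \<partial>lborel)"
    by (rule line_integral_shift) (use assms e(1) in auto)
  moreover have "f (Complex \<sigma> \<omega>) = of_real ((cmod (e (Complex \<sigma> \<omega>)))\<^sup>2)" for \<omega>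
  proof -
    have "2 * \<sigma> - cnj (Complex \<sigma> \<omega>) = Complex \<sigma> \<omega>" by (simp add: complex_eq_iff)
    then show ?thesis by (simp only: f_def complex_norm_square)
  qed
  moreover have "f (Complex 0 \<omega>) = e (Complex 0 \<omega>) * cnj (e (Complex (2 * \<sigma>) \<omega>))" for \<omega>
  proof -
    have "2 * \<sigma> - cnj (Complex 0 \<omega>) = Complex (2 * \<sigma>) \<omega>" by (simp add: complex_eq_iff)
    then show ?thesis by (simp only: f_def)
  qed
  ultimately have "complex_of_real (N \<sigma>) = (\<integral>\<omega>. e (Complex 0 \<omega>) * cnj (e (Complex (2 * \<sigma>) \<omega>)) \<partial>lborel)"
    by (simp add: N_def flip: integral_complex_of_real)
  then have "\<bar>N \<sigma>\<bar> = cmod (\<integral>\<omega>. e (Complex 0 \<omega>) * cnj (e (Complex (2 * \<sigma>) \<omega>)) \<partial>lborel)"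
    by (metis norm_of_real)
  also have "\<dots> \<le> (\<integral>\<omega>. cmod (e (Complex 0 \<omega>) * cnj (e (Complex (2 * \<sigma>) \<omega>))) \<partial>lborel)"
    by (rule integral_norm_bound)
  \<comment> \<open>The pointwise bound \<open>2 * x * y \<le> x\<^sup>2 + y\<^sup>2\<close>, used
    in place of Cauchy-Schwarz, gives the arithmetic mean directly.\<close>
  also have "\<dots> \<le> (\<integral>\<omega>. ((cmod (e (Complex 0 \<omega>)))\<^sup>2 + (cmod (e (Complex (2 * \<sigma>) \<omega>)))\<^sup>2) / 2 \<partial>lborel)"
  proof (rule integral_mono')
    show "integrable lborel (\<lambda>\<omega>. ((cmod (e (Complex 0 \<omega>)))\<^sup>2 + (cmod (e (Complex (2 * \<sigma>) \<omega>)))\<^sup>2) / 2)"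
      using stable_decay_integrable_sq[OF assms(1)] assms(2) by auto
    show "cmod (e (Complex 0 \<omega>) * cnj (e (Complex (2 * \<sigma>) \<omega>)))
        \<le> ((cmod (e (Complex 0 \<omega>)))\<^sup>2 + (cmod (e (Complex (2 * \<sigma>) \<omega>)))\<^sup>2) / 2" for \<omega>
      using sum_squares_bound[of "cmod (e (Complex 0 \<omega>))" "cmod (e (Complex (2 * \<sigma>) \<omega>))"]
      by (simp add: norm_mult)
  qed auto
  also have "\<dots> = (N 0 + N (2 * \<sigma>)) / 2"
    using stable_decay_integrable_sq[OF assms(1)] assms(2) by (auto simp: N_def)
  finally show ?thesis by simp
qed

text \<open>By the midpoint bound the excess over \<open>N 0\<close> is at most half the excess at
  twice the distance. After \<open>k\<close> doublings the uniform bound \<open>B\<close> leaves at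
  most \<open>(B - N 0) / 2 ^ k\<close>, hence nothing in the limit.\<close>

lemma stable_decay_line_norm_le:
  assumes "stable_decay e" "0 < \<sigma>"
  shows "(\<integral>\<omega>. (cmod (e (Complex \<sigma> \<omega>)))\<^sup>2 \<partial>lborel) \<le> (\<integral>\<omega>. (cmod (e (Complex 0 \<omega>)))\<^sup>2 \<partial>lborel)"
proof -
  define N where "N = (\<lambda>\<rho>. \<integral>\<omega>. (cmod (e (Complex \<rho> \<omega>)))\<^sup>2 \<partial>lborel)"
  obtain B where B: "\<And>\<rho>. \<rho> \<ge> 0 \<Longrightarrow> N \<rho> \<le> B"
    using stable_decay_integrable_sq[OF assms(1)] unfolding N_def by blast
  have it: "N \<sigma> - N 0 \<le> (N (2 ^ k * \<sigma>) - N 0) / 2 ^ k" for k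
  proof (induction k)
    case (Suc k)
    have "N (2 ^ k * \<sigma>) - N 0 \<le> (N (2 ^ Suc k * \<sigma>) - N 0) / 2"
      using stable_decay_line_norm_mid[OF assms(1), of "2 ^ k * \<sigma>"] assms(2)
      by (simp add: N_def field_simps)
    then have "(N (2 ^ k * \<sigma>) - N 0) / 2 ^ k \<le> (N (2 ^ Suc k * \<sigma>) - N 0) / 2 / 2 ^ k"
      by (intro divide_right_mono) auto
    with Suc show ?case by simp
  qed simp
  have "N \<sigma> - N 0 \<le> (B - N 0) / 2 ^ k" for k
    by (rule order_trans[OF it]) (use B[of "2 ^ k * \<sigma>"] assms(2) in \<open>auto intro!: divide_right_mono\<close>)
  moreover have "(\<lambda>k. (B - N 0) / 2 ^ k) \<longlonglongrightarrow> 0"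
    by real_asymp
  ultimately have "N \<sigma> - N 0 \<le> 0"
    by (intro LIMSEQ_le_const) auto
  then show ?thesis by (simp add: N_def)
qed

text \<open>The product decays to second order, so its line integral does not depend on the line;
  moving the line to infinity on the right makes it vanish by dominated convergence.\<close>

lemma stable_decay_mult_integral:
  assumes "stable_decay e" "stable_decay f"
  shows "integrable lborel (\<lambda>\<omega>. e (Complex 0 \<omega>) * f (Complex 0 \<omega>))"
    and "(\<integral>\<omega>. e (Complex 0 \<omega>) * f (Complex 0 \<omega>) \<partial>lborel) = 0"
proof -
  obtain \<epsilon> K where e: "\<epsilon> > 0" "e holomorphic_on {s. - \<epsilon> < Re s}"
    "\<And>s. - \<epsilon> < Re s \<Longrightarrow> cmod (e s) \<le> K / (1 + cmod s)"
    using assms(1) unfolding stable_decay_def by blast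
  obtain \<delta> J where f: "\<delta> > 0" "f holomorphic_on {s. - \<delta> < Re s}"
    "\<And>s. - \<delta> < Re s \<Longrightarrow> cmod (f s) \<le> J / (1 + cmod s)"
    using assms(2) unfolding stable_decay_def by blast
  define g where "g = (\<lambda>s. e s * f s)"
  define \<rho> where "\<rho> = min \<epsilon> \<delta>"
  have \<rho>: "\<rho> > 0" using e(1) f(1) by (simp add: \<rho>_def)
  have gh: "g holomorphic_on {s. - \<rho> < Re s}"
    unfolding g_def \<rho>_def
    by (intro holomorphic_intros holomorphic_on_subset[OF e(2)] holomorphic_on_subset[OF f(2)]) auto
  have gb: "cmod (g s) \<le> K * J / (1 + (Im s)\<^sup>2)" if "- \<rho> < Re s" for s
    unfolding g_def norm_mult
    by (rule decay_mult[OF e(3) f(3)]) (use that in \<open>auto simp: \<rho>_def\<close>)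
  have gi: "integrable lborel (\<lambda>\<omega>. g (Complex \<sigma> \<omega>))" if "\<sigma> \<ge> 0" for \<sigma>
    by (rule integrable_line[where K = "K * J"])
      (use \<rho> that in \<open>auto intro!: order_trans[OF gb] continuous_on_subset[OF holomorphic_on_imp_continuous_on[OF gh]]\<close>)
  from gi[of 0] show "integrable lborel (\<lambda>\<omega>. e (Complex 0 \<omega>) * f (Complex 0 \<omega>))"
    by (simp add: g_def)
  have shift: "(\<integral>\<omega>. g (Complex (real n) \<omega>) \<partial>lborel) = (\<integral>\<omega>. g (Complex 0 \<omega>) \<partial>lborel)" for n
    by (rule line_integral_shift[where a = "- \<rho>" and b = "real n + 1" and K = "K * J"])
      (use \<rho> in \<open>auto intro!: gb holomorphic_on_subset[OF gh]\<close>)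
  have "(\<lambda>n. \<integral>\<omega>. g (Complex (real n) \<omega>) \<partial>lborel) \<longlonglongrightarrow> (\<integral>\<omega>. 0 \<partial>(lborel :: real measure))"
  proof (rule integral_dominated_convergence[where w = "\<lambda>\<omega>. K * J / (1 + \<omega>\<^sup>2)"])
    show "AE \<omega> in lborel. (\<lambda>n. g (Complex (real n) \<omega>)) \<longlonglongrightarrow> 0"
    proof (rule AE_I2)
      fix \<omega> :: real
      \<comment> \<open>For the pointwise limit it is enough that one factor decays while the other
        stays bounded. The restriction \<open>n \<ge> 1\<close> matters because
        \<open>\<bar>K\<bar> / real 0\<close> is \<open>0\<close> in HOL.\<close>
      have "norm (g (Complex (real n) \<omega>)) \<le> (\<bar>K\<bar> / real n) * \<bar>J\<bar>" if "n \<ge> 1" for n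
      proof -
        have n: "real n \<le> cmod (Complex (real n) \<omega>)"
          using abs_Re_le_cmod[of "Complex (real n) \<omega>"] by simp
        have "K / (1 + cmod (Complex (real n) \<omega>)) \<le> \<bar>K\<bar> / (1 + cmod (Complex (real n) \<omega>))"
          by (intro divide_right_mono) auto
        also have "\<dots> \<le> \<bar>K\<bar> / real n"
          using n that by (intro divide_left_mono mult_pos_pos) (auto simp: add_pos_nonneg)
        finally have 1: "K / (1 + cmod (Complex (real n) \<omega>)) \<le> \<bar>K\<bar> / real n" .
        have "J / (1 + cmod (Complex (real n) \<omega>)) \<le> \<bar>J\<bar> / (1 + cmod (Complex (real n) \<omega>))"
          by (intro divide_right_mono) auto
        also have "\<dots> \<le> \<bar>J\<bar> / 1"
          by (intro divide_left_mono) (auto simp: add_pos_nonneg)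
        finally have 2: "J / (1 + cmod (Complex (real n) \<omega>)) \<le> \<bar>J\<bar>" by simp
        show ?thesis
          unfolding g_def norm_mult using 1 2 e(1) f(1)
          by (intro mult_mono order_trans[OF e(3) 1] order_trans[OF f(3) 2]) auto
      qed
      then have "eventually (\<lambda>n. norm (g (Complex (real n) \<omega>)) \<le> (\<bar>K\<bar> / real n) * \<bar>J\<bar>) sequentially"
        using eventually_sequentially by blast
      moreover have "(\<lambda>n. (\<bar>K\<bar> / real n) * \<bar>J\<bar>) \<longlonglongrightarrow> 0" by real_asymp
      ultimately show "(\<lambda>n. g (Complex (real n) \<omega>)) \<longlonglongrightarrow> 0" by (rule Lim_null_comparison)
    qed
    show "AE \<omega> in lborel. norm (g (Complex (real n) \<omega>)) \<le> K * J / (1 + \<omega>\<^sup>2)" for n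
      using \<rho> by (auto intro!: AE_I2 order_trans[OF gb])
    show "(\<lambda>\<omega>. g (Complex (real n) \<omega>)) \<in> borel_measurable lborel" for n
      using gi[of "real n"] by auto
  qed (auto intro: integrable_cauchy_kernel)
  \<comment> \<open>The shifted integrals form a constant sequence, so their common value is the
    limit.\<close>
  then have "(\<integral>\<omega>. g (Complex 0 \<omega>) \<partial>lborel) = 0"
    unfolding shift using LIMSEQ_unique tendsto_const by fastforce
  then show "(\<integral>\<omega>. e (Complex 0 \<omega>) * f (Complex 0 \<omega>) \<partial>lborel) = 0"
    by (simp add: g_def)
qed

section \<open>The spectral factorization identity\<close>

lemma matrix_add_rdistrib: "(A + B) ** C = A ** C + B ** (C :: 'a::semiring_1^_^_)"
  by (vector matrix_matrix_mult_def sum.distrib distrib_right)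

lemma matrix_diff_ldistrib: "A ** (B - C) = A ** B - A ** (C :: 'a::ring_1^_^_)"
  by (vector matrix_matrix_mult_def sum_subtractf right_diff_distrib)

lemma matrix_diff_rdistrib: "(A - B) ** C = A ** C - B ** (C :: 'a::ring_1^_^_)"
  by (vector matrix_matrix_mult_def sum_subtractf left_diff_distrib)

lemma transpose_add: "transpose (A + B) = transpose A + transpose B"
  by (vector transpose_def)

lemma transpose_diff: "transpose (A - B) = transpose A - transpose B"
  by (vector transpose_def)

lemma mat_mul_comm: "mat s ** A = A ** mat (s :: 'a::comm_semiring_1)"
proof -
  have "(mat s ** A) $ i $ j = s * A $ i $ j" for i j
    by (simp add: matrix_matrix_mult_def mat_def if_distrib[where f = "\<lambda>x. x * _"] cong: if_cong)
  moreover have "(A ** mat s) $ i $ j = A $ i $ j * s" for i j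
    by (simp add: matrix_matrix_mult_def mat_def if_distrib[where f = "(*) _"] cong: if_cong)
  ultimately show ?thesis by (simp add: vec_eq_iff mult.commute)
qed

lemma mat_vector_mult: "mat s *v v = s *s (v :: 'a::semiring_1^_)"
  by (simp add: vec_eq_iff matrix_vector_mult_def mat_def if_distrib[where f = "\<lambda>x. x * _"] cong: if_cong)

lemma cmat_mult: "cmat (P ** Q) = cmat P ** cmat Q"
  by (simp add: cmat_def matrix_matrix_mult_def vec_eq_iff)

lemma cmat_add: "cmat (P + Q) = cmat P + cmat Q"
  by (simp add: cmat_def vec_eq_iff)

lemma cmat_diff: "cmat (P - Q) = cmat P - cmat Q"
  by (simp add: cmat_def vec_eq_iff)

lemma cmat_transpose: "cmat (transpose P) = transpose (cmat P)"
  by (simp add: cmat_def transpose_def vec_eq_iff)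

lemma matrix_inv_mult:
  assumes "invertible M"
  shows "M ** matrix_inv M = mat 1" "matrix_inv M ** M = mat 1"
proof -
  from assms obtain N where "M ** N = mat 1 \<and> N ** M = mat 1"
    unfolding invertible_def by blast
  then have "M ** matrix_inv M = mat 1 \<and> matrix_inv M ** M = mat 1"
    unfolding matrix_inv_def by (rule someI)
  then show "M ** matrix_inv M = mat 1" "matrix_inv M ** M = mat 1" by auto
qed

lemma KYP_blocks:
  assumes "KYP_matrix A B C D X = vcat (transpose L) (transpose M) ** hcat L M"
  shows "- (transpose A ** X) - X ** A = transpose L ** L"
    and "transpose C - X ** B = transpose L ** M"
    and "C - transpose B ** X = transpose M ** L"
    and "D + transpose D = transpose M ** M"
proof -
  have e: "KYP_matrix A B C D X $ i $ j = (vcat (transpose L) (transpose M) ** hcat L M) $ i $ j" for i j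
    using assms by simp
  have "(- (transpose A ** X) - X ** A) $ i $ j = (transpose L ** L) $ i $ j" for i j
    using e[of "Inl i" "Inl j"] by (simp add: KYP_matrix_def vcat_def hcat_def matrix_matrix_mult_def)
  then show "- (transpose A ** X) - X ** A = transpose L ** L" unfolding vec_eq_iff by blast
  have "(transpose C - X ** B) $ i $ j = (transpose L ** M) $ i $ j" for i j
    using e[of "Inl i" "Inr j"] by (simp add: KYP_matrix_def vcat_def hcat_def matrix_matrix_mult_def)
  then show "transpose C - X ** B = transpose L ** M" unfolding vec_eq_iff by blast
  have "(C - transpose B ** X) $ i $ j = (transpose M ** L) $ i $ j" for i j
    using e[of "Inr i" "Inl j"] by (simp add: KYP_matrix_def vcat_def hcat_def matrix_matrix_mult_def)
  then show "C - transpose B ** X = transpose M ** L" unfolding vec_eq_iff by blast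
  have "(D + transpose D) $ i $ j = (transpose M ** M) $ i $ j" for i j
    using e[of "Inr i" "Inr j"] by (simp add: KYP_matrix_def vcat_def hcat_def matrix_matrix_mult_def)
  then show "D + transpose D = transpose M ** M" unfolding vec_eq_iff by blast
qed

text \<open>In the upper left block, adding and subtracting \<open>s\<close> times \<open>x\<close>
  produces the factors \<open>mat (- s) - transpose a\<close> and \<open>mat s - a\<close>. The
  resolvents on either side remove them, and the remaining terms in \<open>x\<close> cancel against
  those of the off-diagonal blocks.\<close>

lemma spectral_factorization:
  fixes A :: "real^'n^'n"
  assumes "spectral_factor A B C D L M"
    and "invertible (mat s - cmat A)" "invertible (mat (- s) - cmat A)"
  shows "transfer A B C D s + transpose (transfer A B C D (- s))
       = transpose (transfer A B L M (- s)) ** transfer A B L M s"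
proof -
  obtain X where X: "KYP_matrix A B C D X = vcat (transpose L) (transpose M) ** hcat L M"
    using assms(1) unfolding spectral_factor_def by blast
  define a b c d l m x where defs: "a = cmat A" "b = cmat B" "c = cmat C" "d = cmat D"
    "l = cmat L" "m = cmat M" "x = cmat X"
  \<comment> \<open>The resolvent at \<open>s\<close> and the transposed resolvent at
    \<open>- s\<close>, as they occur in the two factors of the product.\<close>
  define p q where pq: "p = matrix_inv (mat s - a)" "q = transpose (matrix_inv (mat (- s) - a))"
  note blocks = KYP_blocks[OF X, THEN arg_cong[where f = cmat]]
  have "cmat (- (transpose A ** X) - X ** A) = - (transpose a ** x) - x ** a"
    by (simp add: defs vec_eq_iff cmat_def matrix_matrix_mult_def transpose_def)
  with blocks(1) have "transpose l ** l = - (transpose a ** x) - x ** a"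
    by (simp add: cmat_mult cmat_transpose defs)
  also have "\<dots> = (mat (- s) - transpose a) ** x + x ** (mat s - a)"
  proof -
    have "mat (- s) ** x = - (mat s ** x)"
      by (simp add: vec_eq_iff matrix_matrix_mult_def mat_def sum_negf[symmetric] if_distrib[where f = uminus] if_distrib[where f = "\<lambda>x. x * _"] cong: if_cong)
    then show ?thesis
      by (simp add: matrix_diff_ldistrib matrix_diff_rdistrib mat_mul_comm[of s x])
  qed
  finally have b1: "transpose l ** l = (mat (- s) - transpose a) ** x + x ** (mat s - a)" .
  have b2: "transpose l ** m = transpose c - x ** b"
    using blocks(2) by (simp add: cmat_mult cmat_transpose cmat_diff defs)
  have b3: "transpose m ** l = c - transpose b ** x"
    using blocks(3) by (simp add: cmat_mult cmat_transpose cmat_diff defs)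
  have b4: "transpose m ** m = d + transpose d"
    using blocks(4) by (simp add: cmat_mult cmat_transpose cmat_add defs)
  have p: "(mat s - a) ** p = mat 1"
    using matrix_inv_mult(1)[OF assms(2)] by (simp add: pq defs)
  have "transpose ((mat (- s) - a) ** matrix_inv (mat (- s) - a)) = mat 1"
    using matrix_inv_mult(1)[OF assms(3)] by (simp add: defs)
  then have q: "q ** (mat (- s) - transpose a) = mat 1"
    by (simp add: matrix_transpose_mul transpose_diff pq)
  have "q ** (transpose l ** l) ** p = q ** (mat (- s) - transpose a) ** x ** p + q ** x ** ((mat s - a) ** p)"
    by (simp add: b1 matrix_add_ldistrib matrix_add_rdistrib matrix_mul_assoc)
  then have key: "q ** (transpose l ** l) ** p = x ** p + q ** x"
    by (simp add: p q)
  have "transpose (transfer A B L M (- s)) ** transfer A B L M s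
      = (transpose b ** q ** transpose l + transpose m) ** (l ** p ** b + m)"
    by (simp add: transfer_def defs pq transpose_add matrix_transpose_mul matrix_mul_assoc)
  also have "\<dots> = transpose b ** (q ** (transpose l ** l) ** p) ** b + transpose b ** q ** (transpose l ** m)
      + (transpose m ** l) ** p ** b + transpose m ** m"
    by (simp add: matrix_add_ldistrib matrix_add_rdistrib matrix_mul_assoc)
  \<comment> \<open>The terms \<open>transpose b ** x ** p ** b\<close> and
    \<open>transpose b ** q ** x ** b\<close> from \<open>key\<close> cancel against those from
    \<open>b3\<close> and \<open>b2\<close>.\<close>
  also have "\<dots> = transpose b ** q ** transpose c + c ** p ** b + d + transpose d"
    unfolding key b2 b3 b4
    by (simp add: matrix_add_ldistrib matrix_add_rdistrib matrix_diff_ldistrib matrix_diff_rdistrib matrix_mul_assoc)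
  also have "\<dots> = transfer A B C D s + transpose (transfer A B C D (- s))"
    by (simp add: transfer_def defs pq transpose_add matrix_transpose_mul matrix_mul_assoc)
  finally show ?thesis by simp
qed

text \<open>Composed with \<open>transpose\<close> this is the adjoint of a complex matrix.\<close>

definition cnj_mat :: "complex^'b^'a \<Rightarrow> complex^'b^'a" where
  "cnj_mat M = (\<chi> i j. cnj (M $ i $ j))"

lemma cnj_mat_simps [simp]:
  "cnj_mat (P + Q) = cnj_mat P + cnj_mat Q" "cnj_mat (P - Q) = cnj_mat P - cnj_mat Q"
  "cnj_mat (R ** S) = cnj_mat R ** cnj_mat S" "cnj_mat (cmat U) = cmat U" "cnj_mat (mat s) = mat (cnj s)"
  by (simp_all add: cnj_mat_def cmat_def matrix_matrix_mult_def vec_eq_iff mat_def)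

text \<open>The system matrices are real, so conjugating the equations of the inverse gives those at
  \<open>cnj s\<close>, and inverses are unique. On the imaginary axis \<open>- s = cnj s\<close>,
  which turns \<open>transpose (H (- s))\<close> into the adjoint of \<open>H s\<close>.\<close>

lemma transfer_cnj:
  assumes "invertible (mat s - cmat A)"
  shows "transfer A B C D (cnj s) = cnj_mat (transfer A B C D s)"
proof -
  let ?M = "mat s - cmat A"
  have "cnj_mat (?M ** matrix_inv ?M) = mat 1" "cnj_mat (matrix_inv ?M ** ?M) = mat 1"
    by (simp_all only: matrix_inv_mult[OF assms] cnj_mat_simps complex_cnj_one)
  then have l: "(mat (cnj s) - cmat A) ** cnj_mat (matrix_inv ?M) = mat 1"
    and r: "cnj_mat (matrix_inv ?M) ** (mat (cnj s) - cmat A) = mat 1" by simp_all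
  then have "invertible (mat (cnj s) - cmat A)" unfolding invertible_def by blast
  from matrix_inv_mult(2)[OF this] l
  have "matrix_inv (mat (cnj s) - cmat A) = cnj_mat (matrix_inv ?M)"
    by (metis matrix_mul_assoc matrix_mul_lid matrix_mul_rid)
  then show ?thesis unfolding transfer_def by simp
qed

section \<open>Frobenius and spectral norm\<close>

text \<open>Cauchy-Schwarz applied to the moduli. The pairing is bilinear, without conjugation, as
  in matrix products.\<close>

lemma sum_mult_norm_le:
  fixes x y :: "complex^'a"
  shows "cmod (\<Sum>i\<in>UNIV. x $ i * y $ i) \<le> norm x * norm y"
proof -
  have "cmod (\<Sum>i\<in>UNIV. x $ i * y $ i) \<le> (\<Sum>i\<in>UNIV. \<bar>cmod (x $ i)\<bar> * \<bar>cmod (y $ i)\<bar>)"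
    by (rule order_trans[OF norm_sum]) (simp add: norm_mult)
  also have "\<dots> \<le> norm x * norm y"
    unfolding norm_vec_def by (rule L2_set_mult_ineq)
  finally show ?thesis .
qed

text \<open>Cauchy-Schwarz row by row. It makes \<open>onorm\<close> usable and bounds it by the
  Frobenius norm.\<close>

lemma norm_matrix_vector_le_frobenius:
  fixes M :: "complex^'b^'a"
  shows "norm (M *v v) \<le> norm M * norm v"
proof -
  have "norm (M *v v) \<le> L2_set (\<lambda>i. norm (M $ i) * norm v) UNIV"
    unfolding norm_vec_def[of "M *v v"]
    by (rule L2_set_mono) (auto simp: matrix_vector_mult_def intro: sum_mult_norm_le)
  also have "\<dots> = norm M * norm v"
    by (simp add: norm_vec_def[of M] L2_set_left_distrib)
  finally show ?thesis .
qed

lemma bounded_linear_cmatrix: "bounded_linear ((*v) (M :: complex^'b^'a))"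
proof (rule bounded_linear_intro[where K = "norm M"])
  show "norm (M *v v) \<le> norm v * norm M" for v
    using norm_matrix_vector_le_frobenius[of M v] by (simp add: mult.commute)
  show "M *v (r *\<^sub>R v) = r *\<^sub>R (M *v v)" for r v
    by (simp add: vec_eq_iff matrix_vector_mult_def scaleR_sum_right)
qed (rule matrix_vector_right_distrib)

lemma spectral_norm_bound: "norm (M *v v) \<le> spectral_norm M * norm v"
  unfolding spectral_norm_def by (rule onorm[OF bounded_linear_cmatrix])

lemma spectral_norm_nonneg: "0 \<le> spectral_norm M"
  unfolding spectral_norm_def by (rule onorm_pos_le[OF bounded_linear_cmatrix])

lemma spectral_norm_le_norm: "spectral_norm M \<le> norm M"
  unfolding spectral_norm_def by (rule onorm_bound) (auto intro: norm_matrix_vector_le_frobenius)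

text \<open>By the triangle inequality the spectral norm is 1-Lipschitz for the Frobenius norm.
  Continuity makes the function inside the essential supremum measurable.\<close>

lemma continuous_on_spectral_norm: "continuous_on UNIV (spectral_norm :: complex^'b^'a \<Rightarrow> real)"
proof -
  have *: "spectral_norm M \<le> spectral_norm N + norm (M - N)" for M N :: "complex^'b^'a"
  proof -
    have "spectral_norm M = onorm (\<lambda>v. N *v v + (M - N) *v v)"
      by (simp add: spectral_norm_def flip: matrix_vector_mult_add_rdistrib)
    also have "\<dots> \<le> spectral_norm N + spectral_norm (M - N)"
      unfolding spectral_norm_def by (intro onorm_triangle bounded_linear_cmatrix)
    finally show ?thesis using spectral_norm_le_norm[of "M - N"] by simp
  qed
  have "1-lipschitz_on UNIV (spectral_norm :: complex^'b^'a \<Rightarrow> real)"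
  proof (rule lipschitz_onI)
    fix M N :: "complex^'b^'a"
    show "dist (spectral_norm M) (spectral_norm N) \<le> 1 * dist M N"
      using *[of M N] *[of N M] by (simp add: dist_norm abs_le_iff norm_minus_commute)
  qed simp
  then show ?thesis by (rule lipschitz_on_continuous_on)
qed

lemma norm_transpose: "norm (transpose M) = norm (M :: complex^'b^'a)"
proof -
  have "(norm (transpose M))\<^sup>2 = (norm M)\<^sup>2"
    unfolding norm_matrix_eq_frobenius by (subst sum.swap) (simp add: transpose_def)
  then show ?thesis by simp
qed

lemma norm_cnj_mat: "norm (cnj_mat M) = norm M"
proof -
  have "(norm (cnj_mat M))\<^sup>2 = (norm M)\<^sup>2"
    unfolding norm_matrix_eq_frobenius cnj_mat_def by simp
  then show ?thesis by simp
qed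

text \<open>Each column of the product is \<open>P\<close> applied to a column of \<open>Q\<close>.
  Transposing brings columns into the position of rows, from which the library norm is
  built.\<close>

lemma norm_matrix_mult_le_left: "norm (P ** Q) \<le> spectral_norm P * norm (Q :: complex^'c^'b)"
proof -
  have col: "transpose (P ** Q) $ j = P *v (transpose Q $ j)" for j
    by (simp add: vec_eq_iff transpose_def matrix_matrix_mult_def matrix_vector_mult_def)
  have "norm (P ** Q) = L2_set (\<lambda>j. norm (P *v (transpose Q $ j))) UNIV"
    unfolding norm_transpose[of "P ** Q", symmetric] norm_vec_def[of "transpose (P ** Q)"] col ..
  also have "\<dots> \<le> L2_set (\<lambda>j. spectral_norm P * norm (transpose Q $ j)) UNIV"
    by (rule L2_set_mono) (auto intro: spectral_norm_bound)
  also have "\<dots> = spectral_norm P * norm (transpose Q)"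
    by (simp add: norm_vec_def[of "transpose Q"] L2_set_right_distrib spectral_norm_nonneg)
  finally show ?thesis by (simp add: norm_transpose)
qed

text \<open>Transposition does not increase the spectral norm, by duality: pairing \<open>y\<close>
  with its conjugate \<open>z\<close> moves \<open>Q\<close> from \<open>x\<close> to
  \<open>z\<close>, and then one factor \<open>norm y\<close> is cancelled.\<close>

lemma norm_vector_matrix_le: "norm (x v* Q) \<le> norm x * spectral_norm (Q :: complex^'c^'b)"
proof -
  define y where "y = x v* Q"
  define z :: "complex^'c" where "z = (\<chi> j. cnj (y $ j))"
  have nz: "norm z = norm y" by (simp add: z_def norm_vec_def)
  have "complex_of_real ((norm y)\<^sup>2) = (\<Sum>j\<in>UNIV. y $ j * z $ j)"
    by (simp add: norm_vec_def L2_set_def sum_nonneg z_def complex_norm_square[symmetric] flip: of_real_power)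
  also have "\<dots> = (\<Sum>j\<in>UNIV. \<Sum>i\<in>UNIV. x $ i * (Q $ i $ j * z $ j))"
    by (simp add: y_def vector_matrix_mult_def sum_distrib_left sum_distrib_right mult_ac)
  also have "\<dots> = (\<Sum>i\<in>UNIV. x $ i * (Q *v z) $ i)"
    by (subst sum.swap) (simp add: matrix_vector_mult_def sum_distrib_left)
  finally have "(norm y)\<^sup>2 = cmod (\<Sum>i\<in>UNIV. x $ i * (Q *v z) $ i)"
    by (metis norm_of_real abs_power2 real_norm_def)
  also have "\<dots> \<le> norm x * norm (Q *v z)" by (rule sum_mult_norm_le)
  also have "\<dots> \<le> norm x * (spectral_norm Q * norm y)"
    using spectral_norm_bound[of Q z] by (intro mult_left_mono) (simp_all add: nz)
  finally have le: "norm y * norm y \<le> (norm x * spectral_norm Q) * norm y"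
    by (simp add: power2_eq_square mult_ac)
  have "norm y \<le> norm x * spectral_norm Q"
  proof (cases "norm y = 0")
    case True
    then show ?thesis using spectral_norm_nonneg[of Q] by simp
  next
    case False
    then show ?thesis by (intro mult_right_le_imp_le[OF le]) simp
  qed
  then show ?thesis by (simp add: y_def)
qed

lemma norm_matrix_mult_le_right: "norm (P ** Q) \<le> norm P * spectral_norm (Q :: complex^'c^'b)"
proof -
  have row: "(P ** Q) $ i = (P $ i) v* Q" for i
    by (simp add: vec_eq_iff matrix_matrix_mult_def vector_matrix_mult_def mult.commute)
  have "norm (P ** Q) \<le> L2_set (\<lambda>i. norm (P $ i) * spectral_norm Q) UNIV"
    unfolding norm_vec_def[of "P ** Q"] row by (rule L2_set_mono) (auto intro: norm_vector_matrix_le)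
  also have "\<dots> = norm P * spectral_norm Q"
    by (simp add: norm_vec_def[of P] L2_set_left_distrib spectral_norm_nonneg)
  finally show ?thesis .
qed

section \<open>Resolvents of stable matrices\<close>

lemma matrix_vector_mult_axis: "(M *v axis l 1) $ k = (M :: 'a::semiring_1^_^_) $ k $ l"
  by (simp add: matrix_vector_mult_def axis_def if_distrib[of "(*) _"] cong: if_cong)

lemma singular_imp_eigenvalue:
  assumes "\<not> invertible (mat s - M)"
  shows "eigenvalue M s"
proof -
  obtain v where v: "(mat s - M) *v v = 0" "v \<noteq> 0"
    using assms unfolding invertible_left_inverse matrix_left_invertible_ker by blast
  then have "M *v v = s *s v" by (simp add: matrix_vector_mult_diff_rdistrib mat_vector_mult)
  with v(2) show ?thesis unfolding eigenvalue_def by blast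
qed

text \<open>Makes the spectrum bounded, for the compactness argument that follows.\<close>

lemma eigenvalue_norm_le:
  assumes "eigenvalue M s"
  shows "cmod s \<le> norm M"
proof -
  obtain v where v: "v \<noteq> 0" "M *v v = s *s v"
    using assms unfolding eigenvalue_def by blast
  have "cmod s * norm v = norm (s *s v)"
    by (simp add: norm_vec_def norm_mult L2_set_right_distrib)
  also have "\<dots> \<le> norm M * norm v" using norm_matrix_vector_le_frobenius[of M v] v(2) by simp
  finally show ?thesis using v(1) by simp
qed

lemma holomorphic_on_det:
  fixes M :: "complex \<Rightarrow> complex^'n^'n"
  assumes "\<And>i j. (\<lambda>s. M s $ i $ j) holomorphic_on S"
  shows "(\<lambda>s. det (M s)) holomorphic_on S"
  unfolding det_def by (intro holomorphic_intros assms)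

text \<open>The spectrum is the zero set of the characteristic polynomial, hence compact. The real
  part attains a maximum on it, which is negative and leaves a gap to the axis.\<close>

lemma stable_resolvent_halfplane:
  assumes "asymptotically_stable A"
  shows "\<exists>\<epsilon>>0. \<forall>s. - \<epsilon> < Re s \<longrightarrow> invertible (mat s - cmat A)"
proof -
  define Z where "Z = {s. det (mat s - cmat A) = 0}"
  have Zneg: "Re s < 0 \<and> cmod s \<le> norm (cmat A)" if "s \<in> Z" for s
    using that assms singular_imp_eigenvalue[of s "cmat A"] eigenvalue_norm_le[of "cmat A" s]
    unfolding Z_def asymptotically_stable_def invertible_det_nz by auto
  have "(\<lambda>s. (mat s - cmat A) $ i $ j) holomorphic_on UNIV" for i j
    by (cases "i = j") (auto simp: mat_def intro!: holomorphic_intros)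
  then have "continuous_on UNIV (\<lambda>s. det (mat s - cmat A))"
    by (intro holomorphic_on_imp_continuous_on holomorphic_on_det)
  then have "closed Z" unfolding Z_def by (intro closed_Collect_eq continuous_intros)
  moreover have "bounded Z" using Zneg by (auto intro: boundedI)
  ultimately have "compact Z" by (simp add: compact_eq_bounded_closed)
  show ?thesis
  proof (cases "Z = {}")
    \<comment> \<open>Allowing for an empty spectrum saves a proof that eigenvalues exist; any
      positive number serves here.\<close>
    case True
    then show ?thesis
      unfolding Z_def invertible_det_nz by (intro exI[of _ 1]) auto
  next
    case False
    have "continuous_on Z Re" by (intro continuous_intros)
    then obtain t where t: "t \<in> Z" "\<And>s. s \<in> Z \<Longrightarrow> Re s \<le> Re t"
      using continuous_attains_sup[OF \<open>compact Z\<close> False] by blast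
    then show ?thesis
      using Zneg[OF t(1)] by (intro exI[of _ "- Re t"]) (force simp: Z_def invertible_det_nz)
  qed
qed

text \<open>Cramer's rule writes the entry as a quotient of polynomials in \<open>s\<close>, hence
  holomorphic off the spectrum. Decay for large \<open>s\<close> comes from the resolvent equation;
  on the remaining compact set continuity gives a bound.\<close>

lemma stable_decay_resolvent:
  fixes A :: "real^'n^'n"
  assumes "asymptotically_stable A"
  shows "stable_decay (\<lambda>s. matrix_inv (mat s - cmat A) $ k $ l)"
proof -
  obtain \<epsilon> where \<epsilon>: "\<epsilon> > 0" "\<And>s. - \<epsilon> < Re s \<Longrightarrow> invertible (mat s - cmat A)"
    using stable_resolvent_halfplane[OF assms] by blast
  define P where "P = (\<lambda>s. matrix_inv (mat s - cmat A))"
  define a where "a = norm (cmat A)"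
  have solve: "(mat s - cmat A) *v (P s *v v) = v" if "- \<epsilon> < Re s" for s v
    using matrix_inv_mult(1)[OF \<epsilon>(2)[OF that]] by (simp add: P_def matrix_vector_mul_assoc)
  have cramer_P: "P s $ k $ l = det (\<chi> i j. if j = k then axis l 1 $ i else (mat s - cmat A) $ i $ j) / det (mat s - cmat A)"
    if "- \<epsilon> < Re s" for s
  proof -
    have "P s *v axis l 1 = (\<chi> k. det (\<chi> i j. if j = k then axis l 1 $ i else (mat s - cmat A) $ i $ j) / det (mat s - cmat A))"
      using solve[OF that, of "axis l 1"] \<epsilon>(2)[OF that] by (simp add: invertible_det_nz cramer)
    moreover have "(P s *v axis l 1) $ k = P s $ k $ l"
      by (simp add: matrix_vector_mult_axis)
    ultimately show ?thesis by simp
  qed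
  have entry: "(\<lambda>s. (mat s - cmat A) $ i $ j) holomorphic_on T" for i j T
    by (cases "i = j") (auto simp: mat_def intro!: holomorphic_intros)
  have "(\<lambda>s. det (\<chi> i j. if j = k then axis l 1 $ i else (mat s - cmat A) $ i $ j) / det (mat s - cmat A))
      holomorphic_on {s. - \<epsilon> < Re s}"
  proof (intro holomorphic_on_divide holomorphic_on_det)
    show "(\<lambda>s. (\<chi> i j. if j = k then axis l 1 $ i else (mat s - cmat A) $ i $ j) $ i $ j)
        holomorphic_on {s. - \<epsilon> < Re s}" for i j
      using entry[of i j] by (cases "j = k") auto
  qed (use \<epsilon>(2) entry in \<open>auto simp: invertible_det_nz\<close>)
  then have hol: "(\<lambda>s. P s $ k $ l) holomorphic_on {s. - \<epsilon> < Re s}"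
    by (rule holomorphic_transform) (simp add: cramer_P)
  \<comment> \<open>The resolvent equation gives
    \<open>cmod s * norm v \<le> 1 + a * norm v\<close>. Doubling it and absorbing
    \<open>2 * a * norm v\<close> by the threshold \<open>2 * a + 1\<close> leaves
    \<open>(1 + cmod s) * norm v \<le> 2\<close>.\<close>
  have large: "cmod (P s $ k $ l) \<le> 2 / (1 + cmod s)" if s: "- \<epsilon> < Re s" "2 * a + 1 \<le> cmod s" for s
  proof -
    define v where "v = P s *v axis l 1"
    have "s *s v = axis l 1 + cmat A *v v"
      using solve[OF s(1), of "axis l 1"] unfolding v_def[symmetric]
      by (simp add: matrix_vector_mult_diff_rdistrib mat_vector_mult algebra_simps)
    moreover have "cmod s * norm v = norm (s *s v)"
      by (simp add: norm_vec_def norm_mult L2_set_right_distrib)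
    moreover have "norm (axis l 1 :: complex^'n) = 1" by (simp add: norm_axis_1)
    ultimately have "cmod s * norm v \<le> 1 + a * norm v"
      using norm_triangle_ineq[of "axis l 1" "cmat A *v v"] norm_matrix_vector_le_frobenius[of "cmat A" v]
      unfolding a_def by simp
    moreover have "(2 * a + 1) * norm v \<le> cmod s * norm v"
      by (rule mult_right_mono[OF s(2)]) simp
    ultimately have "(1 + cmod s) * norm v \<le> 2" by (simp add: algebra_simps)
    then have "norm v \<le> 2 / (1 + cmod s)"
      by (simp add: add_pos_nonneg pos_le_divide_eq mult.commute)
    moreover have "cmod (P s $ k $ l) \<le> norm v"
      using Finite_Cartesian_Product.norm_nth_le[of v k]
      by (simp add: v_def matrix_vector_mult_axis)
    ultimately show ?thesis by simp
  qed
  \<comment> \<open>Halving \<open>\<epsilon>\<close> gives a closed half plane inside the open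
    domain of holomorphy, so its part within the ball is compact.\<close>
  define K where "K = {s. - (\<epsilon> / 2) \<le> Re s} \<inter> cball 0 (2 * a + 1)"
  have "compact K"
    unfolding K_def by (intro closed_Int_compact closed_halfspace_Re_ge compact_cball)
  moreover have "continuous_on K (\<lambda>s. P s $ k $ l)"
    by (rule continuous_on_subset[OF holomorphic_on_imp_continuous_on[OF hol]]) (use \<epsilon>(1) in \<open>auto simp: K_def\<close>)
  ultimately have "bounded ((\<lambda>s. P s $ k $ l) ` K)"
    by (intro compact_imp_bounded compact_continuous_image)
  then obtain b where b: "b > 0" "\<And>s. s \<in> K \<Longrightarrow> cmod (P s $ k $ l) \<le> b"
    unfolding bounded_pos by auto
  \<comment> \<open>Inside the ball \<open>1 + cmod s\<close> is at most \<open>2 * a + 2\<close>,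
    which gives the second constant; outside, the constant \<open>2\<close> from
    \<open>large\<close> serves.\<close>
  have bound: "cmod (P s $ k $ l) \<le> max 2 (b * (2 * a + 2)) / (1 + cmod s)" if s: "- (\<epsilon> / 2) < Re s" for s
  proof (cases "2 * a + 1 \<le> cmod s")
    case True
    show ?thesis
      by (rule order_trans[OF large]) (use s \<epsilon>(1) True in \<open>auto intro!: divide_right_mono\<close>)
  next
    case False
    then have "s \<in> K" using s by (simp add: K_def)
    have "(1 + cmod s) * cmod (P s $ k $ l) \<le> (2 * a + 2) * b"
      using False b(1) by (intro mult_mono b(2)[OF \<open>s \<in> K\<close>]) (auto simp: a_def)
    also have "\<dots> \<le> max 2 (b * (2 * a + 2))" by (simp add: mult.commute)
    finally show ?thesis
      by (simp add: add_pos_nonneg pos_le_divide_eq mult.commute)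
  qed
  have "(\<lambda>s. P s $ k $ l) holomorphic_on {s. - (\<epsilon> / 2) < Re s}"
    by (rule holomorphic_on_subset[OF hol]) (use \<epsilon>(1) in auto)
  with bound \<epsilon>(1) have "stable_decay (\<lambda>s. P s $ k $ l)"
    unfolding stable_decay_def by (intro exI[of _ "\<epsilon> / 2"] conjI exI[of _ "max 2 (b * (2 * a + 2))"]) auto
  then show ?thesis by (simp add: P_def)
qed

text \<open>Without the feedthrough, each entry is a fixed linear combination of entries of the
  resolvent.\<close>

lemma stable_decay_transfer:
  assumes "asymptotically_stable A"
  shows "stable_decay (\<lambda>s. (transfer A B C D s - cmat D) $ i $ j)"
proof -
  have "stable_decay (\<lambda>s. \<Sum>l\<in>UNIV. \<Sum>k\<in>UNIV.
      (cmat C $ i $ k * cmat B $ l $ j) * matrix_inv (mat s - cmat A) $ k $ l)"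
    by (intro stable_decay_sum stable_decay_cmult stable_decay_resolvent[OF assms]) auto
  moreover have "(transfer A B C D s - cmat D) $ i $ j = (\<Sum>l\<in>UNIV. \<Sum>k\<in>UNIV.
      (cmat C $ i $ k * cmat B $ l $ j) * matrix_inv (mat s - cmat A) $ k $ l)" for s
    by (simp add: transfer_def matrix_matrix_mult_def sum_distrib_right sum_distrib_left mult_ac)
  ultimately show ?thesis by simp
qed

section \<open>The Hardy norm and the imaginary axis\<close>

lemma continuous_on_matrix:
  fixes F :: "'a::topological_space \<Rightarrow> 'c::topological_space^'b^'d"
  assumes "\<And>i j. continuous_on S (\<lambda>s. F s $ i $ j)"
  shows "continuous_on S F"
proof -
  have "continuous_on S (\<lambda>s. \<chi> i j. F s $ i $ j)"
    by (intro continuous_on_vec_lambda assms)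
  then show ?thesis by simp
qed

lemma continuous_on_transfer:
  assumes "asymptotically_stable A"
  shows "continuous_on {s. 0 \<le> Re s} (transfer A B C D)"
proof (rule continuous_on_matrix)
  fix i j
  have "continuous_on {s. 0 \<le> Re s} (\<lambda>s. (transfer A B C D s - cmat D) $ i $ j + cmat D $ i $ j)"
    by (intro continuous_intros stable_decay_continuous_on stable_decay_transfer assms)
  then show "continuous_on {s. 0 \<le> Re s} (\<lambda>s. transfer A B C D s $ i $ j)" by simp
qed

text \<open>Fatou's lemma along the lines at \<open>inverse (real (Suc n))\<close>, on which
  \<open>F\<close> converges pointwise to its values on the axis by continuity.\<close>

lemma nn_integral_imag_axis_le_H2_norm_sq:
  fixes F :: "complex \<Rightarrow> complex^'b^'a"
  assumes "continuous_on {s. 0 \<le> Re s} F"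
  shows "(\<integral>\<^sup>+ \<omega>. ennreal ((norm (F (Complex 0 \<omega>)))\<^sup>2) \<partial>lborel) \<le> H2_norm_sq F"
proof -
  define \<sigma> where "\<sigma> = (\<lambda>n. inverse (real (Suc n)))"
  have meas: "(\<lambda>\<omega>. ennreal ((norm (F (Complex (\<sigma> n) \<omega>)))\<^sup>2)) \<in> borel_measurable lborel" for n
  proof -
    have "continuous_on UNIV (\<lambda>\<omega>. (norm (F (Complex (\<sigma> n) \<omega>)))\<^sup>2)"
      by (intro continuous_intros continuous_on_line[OF assms]) (simp add: \<sigma>_def)
    then show ?thesis
      by (intro measurable_compose[OF _ measurable_ennreal]) (simp add: borel_measurable_continuous_onI)
  qed
  have "liminf (\<lambda>n. ennreal ((norm (F (Complex (\<sigma> n) \<omega>)))\<^sup>2)) = ennreal ((norm (F (Complex 0 \<omega>)))\<^sup>2)" for \<omega>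
  proof -
    have "(\<lambda>n. Complex (\<sigma> n) \<omega>) \<longlonglongrightarrow> Complex 0 \<omega>"
      unfolding \<sigma>_def by (intro tendsto_Complex tendsto_const LIMSEQ_inverse_real_of_nat)
    then have "(\<lambda>n. F (Complex (\<sigma> n) \<omega>)) \<longlonglongrightarrow> F (Complex 0 \<omega>)"
      by (rule continuous_on_tendsto_compose[OF assms]) (auto simp: \<sigma>_def)
    then have "(\<lambda>n. ennreal ((norm (F (Complex (\<sigma> n) \<omega>)))\<^sup>2)) \<longlonglongrightarrow> ennreal ((norm (F (Complex 0 \<omega>)))\<^sup>2)"
      by (intro tendsto_ennrealI tendsto_intros)
    then show ?thesis by (intro lim_imp_Liminf) auto
  qed
  then have "(\<integral>\<^sup>+ \<omega>. ennreal ((norm (F (Complex 0 \<omega>)))\<^sup>2) \<partial>lborel)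
      = (\<integral>\<^sup>+ \<omega>. liminf (\<lambda>n. ennreal ((norm (F (Complex (\<sigma> n) \<omega>)))\<^sup>2)) \<partial>lborel)" by simp
  also have "\<dots> \<le> liminf (\<lambda>n. \<integral>\<^sup>+ \<omega>. ennreal ((norm (F (Complex (\<sigma> n) \<omega>)))\<^sup>2) \<partial>lborel)"
    by (rule nn_integral_liminf[OF meas])
  also have "\<dots> \<le> H2_norm_sq F"
  proof (rule order_trans[OF Liminf_le_Limsup])
    have "(\<integral>\<^sup>+ \<omega>. ennreal ((norm (F (Complex (\<sigma> n) \<omega>)))\<^sup>2) \<partial>lborel) \<le> H2_norm_sq F" for n
      unfolding H2_norm_sq_def by (rule SUP_upper) (simp add: \<sigma>_def)
    then show "limsup (\<lambda>n. \<integral>\<^sup>+ \<omega>. ennreal ((norm (F (Complex (\<sigma> n) \<omega>)))\<^sup>2) \<partial>lborel) \<le> H2_norm_sq F"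
      by (intro Limsup_bounded always_eventually) auto
  qed simp
  finally show ?thesis .
qed

lemma stable_decay_norm_sq_integrable:
  fixes F :: "complex \<Rightarrow> complex^'b^'a"
  assumes "\<And>i j. stable_decay (\<lambda>s. F s $ i $ j)" "0 \<le> \<sigma>"
  shows "integrable lborel (\<lambda>\<omega>. (norm (F (Complex \<sigma> \<omega>)))\<^sup>2)"
    and "(\<integral>\<omega>. (norm (F (Complex \<sigma> \<omega>)))\<^sup>2 \<partial>lborel)
       = (\<Sum>i\<in>UNIV. \<Sum>j\<in>UNIV. \<integral>\<omega>. (cmod (F (Complex \<sigma> \<omega>) $ i $ j))\<^sup>2 \<partial>lborel)"
proof -
  have i: "integrable lborel (\<lambda>\<omega>. (cmod (F (Complex \<sigma> \<omega>) $ i $ j))\<^sup>2)" for i j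
    using stable_decay_integrable_sq[OF assms(1)[of i j]] assms(2) by blast
  then show "integrable lborel (\<lambda>\<omega>. (norm (F (Complex \<sigma> \<omega>)))\<^sup>2)"
    unfolding norm_matrix_eq_frobenius by (intro Bochner_Integration.integrable_sum)
  show "(\<integral>\<omega>. (norm (F (Complex \<sigma> \<omega>)))\<^sup>2 \<partial>lborel)
       = (\<Sum>i\<in>UNIV. \<Sum>j\<in>UNIV. \<integral>\<omega>. (cmod (F (Complex \<sigma> \<omega>) $ i $ j))\<^sup>2 \<partial>lborel)"
    unfolding norm_matrix_eq_frobenius by (simp add: i Bochner_Integration.integral_sum)
qed

text \<open>The comparison of a line with the axis holds for each entry, and squared Frobenius norms
  add up over the entries.\<close>

lemma H2_norm_sq_le_imag_axis:
  fixes F :: "complex \<Rightarrow> complex^'b^'a"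
  assumes "\<And>i j. stable_decay (\<lambda>s. F s $ i $ j)"
  shows "H2_norm_sq F \<le> ennreal (\<integral>\<omega>. (norm (F (Complex 0 \<omega>)))\<^sup>2 \<partial>lborel)"
  unfolding H2_norm_sq_def
proof (rule SUP_least)
  fix \<sigma> :: real assume "\<sigma> \<in> {0<..}"
  then have \<sigma>: "0 < \<sigma>" by simp
  have "(\<integral>\<omega>. (norm (F (Complex \<sigma> \<omega>)))\<^sup>2 \<partial>lborel) \<le> (\<integral>\<omega>. (norm (F (Complex 0 \<omega>)))\<^sup>2 \<partial>lborel)"
    using \<sigma> by (simp add: stable_decay_norm_sq_integrable(2)[OF assms] sum_mono stable_decay_line_norm_le[OF assms])
  then show "(\<integral>\<^sup>+ \<omega>. ennreal ((norm (F (Complex \<sigma> \<omega>)))\<^sup>2) \<partial>lborel)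
      \<le> ennreal (\<integral>\<omega>. (norm (F (Complex 0 \<omega>)))\<^sup>2 \<partial>lborel)"
    using \<sigma> by (subst nn_integral_eq_integral) (auto intro!: stable_decay_norm_sq_integrable(1)[OF assms] ennreal_leI)
qed

text \<open>On the line \<open>Re s = 1\<close>, an arbitrary choice, \<open>K\<close> is the
  difference of two square-integrable functions, and a nonzero constant is not square integrable
  over an infinite line. It is meant for the difference of two feedthrough matrices.\<close>

lemma H2_norm_sq_finite_imp_strictly_proper:
  fixes F :: "complex \<Rightarrow> complex^'b^'a"
  assumes "H2_norm_sq F < \<infinity>" "\<And>i j. stable_decay (\<lambda>s. (F s - K) $ i $ j)"
  shows "K = 0"
proof -
  have "(\<integral>\<^sup>+ \<omega>. ennreal ((norm K)\<^sup>2) \<partial>(lborel :: real measure))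
    \<le> (\<integral>\<^sup>+ \<omega>. 2 * ennreal ((norm (F (Complex 1 \<omega>)))\<^sup>2) + 2 * ennreal ((norm (F (Complex 1 \<omega>) - K))\<^sup>2) \<partial>lborel)"
  proof (rule nn_integral_mono)
    fix \<omega> :: real
    let ?x = "F (Complex 1 \<omega>)"
    have "norm K \<le> norm ?x + norm (?x - K)"
      using norm_triangle_ineq4[of ?x "?x - K"] by simp
    then have "(norm K)\<^sup>2 \<le> (norm ?x + norm (?x - K))\<^sup>2" by (simp add: power_mono)
    also have "\<dots> \<le> 2 * (norm ?x)\<^sup>2 + 2 * (norm (?x - K))\<^sup>2"
      using sum_squares_bound[of "norm ?x" "norm (?x - K)"] by (simp add: power2_sum)
    finally show "ennreal ((norm K)\<^sup>2) \<le> 2 * ennreal ((norm ?x)\<^sup>2) + 2 * ennreal ((norm (?x - K))\<^sup>2)"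
      by (simp add: ennreal_leI flip: ennreal_plus ennreal_mult'' ennreal_numeral)
  qed
  also have "\<dots> = 2 * (\<integral>\<^sup>+ \<omega>. ennreal ((norm (F (Complex 1 \<omega>)))\<^sup>2) \<partial>lborel)
      + 2 * (\<integral>\<^sup>+ \<omega>. ennreal ((norm (F (Complex 1 \<omega>) - K))\<^sup>2) \<partial>lborel)"
  proof -
    have c: "continuous_on UNIV (\<lambda>\<omega>. F (Complex 1 \<omega>) - K)"
      by (intro continuous_on_line continuous_on_matrix stable_decay_continuous_on assms(2)) simp
    have "continuous_on UNIV (\<lambda>\<omega>. F (Complex 1 \<omega>))"
      using continuous_on_add[OF c continuous_on_const[of UNIV K]] by simp
    then have "(\<lambda>\<omega>. (norm (F (Complex 1 \<omega>)))\<^sup>2) \<in> borel_measurable lborel"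
      by (simp add: borel_measurable_continuous_onI continuous_on_norm continuous_on_power)
    moreover from c have "(\<lambda>\<omega>. (norm (F (Complex 1 \<omega>) - K))\<^sup>2) \<in> borel_measurable lborel"
      by (simp add: borel_measurable_continuous_onI continuous_on_norm continuous_on_power)
    ultimately show ?thesis by (simp add: nn_integral_add nn_integral_cmult)
  qed
  also have "\<dots> < \<infinity>"
  proof -
    have "(\<integral>\<^sup>+ \<omega>. ennreal ((norm (F (Complex 1 \<omega>)))\<^sup>2) \<partial>lborel) \<le> H2_norm_sq F"
      unfolding H2_norm_sq_def by (rule SUP_upper) simp
    then have "(\<integral>\<^sup>+ \<omega>. ennreal ((norm (F (Complex 1 \<omega>)))\<^sup>2) \<partial>lborel) < \<infinity>"
      using assms(1) by (rule le_less_trans)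
    moreover have "(\<integral>\<^sup>+ \<omega>. ennreal ((norm (F (Complex 1 \<omega>) - K))\<^sup>2) \<partial>lborel) < \<infinity>"
      using stable_decay_norm_sq_integrable(1)[of "\<lambda>s. F s - K" 1, OF assms(2)]
      by (subst nn_integral_eq_integral) auto
    ultimately show ?thesis by (simp add: ennreal_mult_less_top)
  qed
  finally show "K = 0"
    by (cases "norm K = 0") (auto simp: ennreal_mult_eq_top_iff ennreal_top_mult ennreal_mult_top)
qed

text \<open>Replaces the extended-real norm by a real number \<open>a\<close>, so that the estimate
  can be carried out in the reals.\<close>

lemma Linf_imag_norm_finite:
  fixes F :: "complex \<Rightarrow> complex^'b^'a"
  assumes "continuous_on UNIV (\<lambda>\<omega>. F (Complex 0 \<omega>))" "\<And>\<omega>. norm (F (Complex 0 \<omega>)) \<le> b"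
  obtains a where "0 \<le> a" "Linf_imag_norm F = ereal a" "AE \<omega> in lborel. spectral_norm (F (Complex 0 \<omega>)) \<le> a"
proof -
  have "continuous_on UNIV (\<lambda>\<omega>. spectral_norm (F (Complex 0 \<omega>)))"
    by (rule continuous_on_compose2[OF continuous_on_spectral_norm assms(1)]) simp
  \<comment> \<open>The library sets \<open>esssup\<close> of a non-measurable function to top, so
    measurability has to come before any finite bound.\<close>
  then have meas: "(\<lambda>\<omega>. ereal (spectral_norm (F (Complex 0 \<omega>)))) \<in> borel_measurable lborel"
    by (intro borel_measurable_ereal) (simp add: borel_measurable_continuous_onI)
  have "Linf_imag_norm F \<le> ereal b"
    unfolding Linf_imag_norm_def
    by (rule esssup_I[OF meas]) (auto intro!: AE_I2 order_trans[OF spectral_norm_le_norm assms(2)])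
  moreover have "0 \<le> Linf_imag_norm F"
  proof -
    \<comment> \<open>Comparison with the zero function, whose essential supremum is
      \<open>0\<close> because the measure is nonzero.\<close>
    have "esssup lborel (\<lambda>\<omega>::real. 0) \<le> Linf_imag_norm F"
      unfolding Linf_imag_norm_def by (rule esssup_mono) (auto simp: spectral_norm_nonneg)
    moreover have "esssup lborel (\<lambda>\<omega>::real. 0 :: ereal) = 0" by (rule esssup_const) simp
    ultimately show ?thesis by simp
  qed
  ultimately obtain a where a: "0 \<le> a" "Linf_imag_norm F = ereal a"
    by (cases "Linf_imag_norm F") auto
  moreover have "AE \<omega> in lborel. ereal (spectral_norm (F (Complex 0 \<omega>))) \<le> ereal a"
    unfolding a(2)[symmetric] Linf_imag_norm_def by (rule esssup_AE)
  ultimately show ?thesis using that by simp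
qed

text \<open>Expanding the square gives twice the squared norm plus twice the real part of the trace
  of the square of \<open>E\<close>. The factor \<open>2\<close> is the source of
  \<open>1 / sqrt 2\<close> in the final constant.\<close>

lemma integral_norm_sq_add_adjoint:
  fixes E :: "complex \<Rightarrow> complex^'m^'m"
  assumes "\<And>i j. stable_decay (\<lambda>s. E s $ i $ j)"
  shows "integrable lborel (\<lambda>\<omega>. (norm (E (Complex 0 \<omega>) + transpose (cnj_mat (E (Complex 0 \<omega>)))))\<^sup>2)"
    and "(\<integral>\<omega>. (norm (E (Complex 0 \<omega>) + transpose (cnj_mat (E (Complex 0 \<omega>)))))\<^sup>2 \<partial>lborel)
       = 2 * (\<integral>\<omega>. (norm (E (Complex 0 \<omega>)))\<^sup>2 \<partial>lborel)"
proof -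
  define T where "T = (\<lambda>\<omega>. \<Sum>i\<in>UNIV. \<Sum>j\<in>UNIV. E (Complex 0 \<omega>) $ i $ j * E (Complex 0 \<omega>) $ j $ i)"
  have expand: "(norm (P + transpose (cnj_mat P)))\<^sup>2
      = 2 * (norm P)\<^sup>2 + 2 * Re (\<Sum>i\<in>UNIV. \<Sum>j\<in>UNIV. P $ i $ j * P $ j $ i)" for P :: "complex^'m^'m"
  proof -
    \<comment> \<open>The conjugate on \<open>y\<close> makes the cross term the plain product
      \<open>x * y\<close>, which is analytic in \<open>s\<close> once entries of \<open>E\<close>
      are inserted.\<close>
    have z: "(cmod (x + cnj y))\<^sup>2 = (cmod x)\<^sup>2 + (cmod y)\<^sup>2 + 2 * Re (x * y)" for x y
      unfolding cmod_power2 by (simp add: power2_eq_square algebra_simps)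
    have "(norm (P + transpose (cnj_mat P)))\<^sup>2 = (norm P)\<^sup>2
        + (\<Sum>i\<in>UNIV. \<Sum>j\<in>UNIV. (cmod (P $ j $ i))\<^sup>2) + 2 * Re (\<Sum>i\<in>UNIV. \<Sum>j\<in>UNIV. P $ i $ j * P $ j $ i)"
      unfolding norm_matrix_eq_frobenius
      by (simp add: transpose_def cnj_mat_def z sum.distrib sum_distrib_left)
    also have "(\<Sum>i\<in>UNIV. \<Sum>j\<in>UNIV. (cmod (P $ j $ i))\<^sup>2) = (norm P)\<^sup>2"
      unfolding norm_matrix_eq_frobenius by (rule sum.swap)
    finally show ?thesis by simp
  qed
  \<comment> \<open>\<open>E\<close> is orthogonal to its adjoint because \<open>tr (E\<^sup>2)\<close> integrates to zero.\<close>
  have T: "integrable lborel T" "(\<integral>\<omega>. T \<omega> \<partial>lborel) = 0"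
    unfolding T_def
    by (simp_all add: stable_decay_mult_integral[OF assms assms])
  have E: "integrable lborel (\<lambda>\<omega>. (norm (E (Complex 0 \<omega>)))\<^sup>2)"
    by (intro stable_decay_norm_sq_integrable(1) assms) simp
  have eq: "(norm (E (Complex 0 \<omega>) + transpose (cnj_mat (E (Complex 0 \<omega>)))))\<^sup>2
      = 2 * (norm (E (Complex 0 \<omega>)))\<^sup>2 + 2 * Re (T \<omega>)" for \<omega>
    unfolding T_def by (rule expand)
  have ReT: "integrable lborel (\<lambda>\<omega>. Re (T \<omega>))" "(\<integral>\<omega>. Re (T \<omega>) \<partial>lborel) = 0"
    using T by (simp_all add: integral_Re)
  show "integrable lborel (\<lambda>\<omega>. (norm (E (Complex 0 \<omega>) + transpose (cnj_mat (E (Complex 0 \<omega>)))))\<^sup>2)"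
    unfolding eq using E ReT(1) by simp
  show "(\<integral>\<omega>. (norm (E (Complex 0 \<omega>) + transpose (cnj_mat (E (Complex 0 \<omega>)))))\<^sup>2 \<partial>lborel)
       = 2 * (\<integral>\<omega>. (norm (E (Complex 0 \<omega>)))\<^sup>2 \<partial>lborel)"
    unfolding eq using E ReT by simp
qed

text \<open>A decaying part plus the constant feedthrough is bounded on the axis; this makes the
  essential suprema finite.\<close>

lemma transfer_bounded:
  assumes "asymptotically_stable A"
  obtains b where "\<And>\<omega>. norm (transfer A B C D (Complex 0 \<omega>)) \<le> b"
proof -
  have "\<exists>K. \<forall>\<omega>. cmod (transfer A B C D (Complex 0 \<omega>) $ i $ j) \<le> K" for i j
  proof -
    obtain \<epsilon> K where e: "\<epsilon> > 0"
      "\<And>s. - \<epsilon> < Re s \<Longrightarrow> cmod ((transfer A B C D s - cmat D) $ i $ j) \<le> K / (1 + cmod s)"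
      using stable_decay_transfer[OF assms] unfolding stable_decay_def by blast
    have "cmod (transfer A B C D (Complex 0 \<omega>) $ i $ j) \<le> \<bar>K\<bar> + cmod (cmat D $ i $ j)" for \<omega>
    proof -
      let ?s = "Complex 0 \<omega>"
      have "cmod ((transfer A B C D ?s - cmat D) $ i $ j) \<le> K / (1 + cmod ?s)"
        using e by simp
      also have "\<dots> \<le> \<bar>K\<bar> / (1 + cmod ?s)" by (intro divide_right_mono) auto
      also have "\<dots> \<le> \<bar>K\<bar> / 1" by (intro divide_left_mono) (auto simp: add_pos_nonneg)
      finally show ?thesis
        using norm_triangle_ineq[of "(transfer A B C D ?s - cmat D) $ i $ j" "cmat D $ i $ j"] by simp
    qed
    then show ?thesis by blast
  qed
  then obtain K where K: "\<And>i j \<omega>. cmod (transfer A B C D (Complex 0 \<omega>) $ i $ j) \<le> K i j" by metis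
  have "norm (transfer A B C D (Complex 0 \<omega>)) \<le> L2_set (\<lambda>i. L2_set (K i) UNIV) UNIV" for \<omega>
    unfolding norm_vec_def by (intro L2_set_mono K) auto
  then show ?thesis using that by blast
qed

section \<open>The \<open>H\<^sub>2\<close> error bound in terms of spectral factors\<close>

theorem theorem3p1:
  fixes A :: "real^'n^'n" and B :: "real^'m^'n" and C :: "real^'n^'m" and D :: "real^'m^'m"
    and A' :: "real^'r^'r" and B' :: "real^'m^'r" and C' :: "real^'r^'m" and D' :: "real^'m^'m"
    and L :: "real^'n^'k" and M :: "real^'m^'k"
    and L' :: "real^'r^'k" and M' :: "real^'m^'k"
    and G G' :: "complex \<Rightarrow> complex^'m^'m"
    and H H' :: "complex \<Rightarrow> complex^'m^'k"
  assumes "passive_system A B C D" and "minimal_system A B C D" and "asymptotically_stable A"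
    and "passive_system A' B' C' D'" and "minimal_system A' B' C' D'" and "asymptotically_stable A'"
    and "spectral_factor A B C D L M"
    and "spectral_factor A' B' C' D' L' M'"
    and "G = transfer A B C D" and "G' = transfer A' B' C' D'"
    and "H = transfer A B L M" and "H' = transfer A' B' L' M'"
    and "(\<lambda>s. G s - G' s) \<in> hardy_H2"
    and "(\<lambda>s. H s - H' s) \<in> hardy_H2"
  shows "ereal (H2_norm (\<lambda>s. G s - G' s)) \<le> factor_const H H' * ereal (H2_norm (\<lambda>s. H s - H' s))"
proof -
  note stab = assms(3) and stab' = assms(6)
  define E where "E = (\<lambda>s. G s - G' s)"
  define \<Delta> where "\<Delta> = (\<lambda>s. H s - H' s)"

  \<comment> \<open>Factorization identities on the imaginary axis\<close>
  have invA: "invertible (mat (Complex 0 \<omega>) - cmat A)" "invertible (mat (Complex 0 \<omega>) - cmat A')" for \<omega>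
    using stable_resolvent_halfplane[OF stab] stable_resolvent_halfplane[OF stab'] by auto
  \<comment> \<open>Two readings of the reflected point: as another point of the axis it inherits
    invertibility and bounds, as the conjugate it yields adjoints.\<close>
  have neg: "- Complex 0 \<omega> = Complex 0 (- \<omega>)" "- Complex 0 \<omega> = cnj (Complex 0 \<omega>)" for \<omega>
    by (simp_all add: complex_eq_iff)
  have invN: "invertible (mat (- Complex 0 \<omega>) - cmat A)" "invertible (mat (- Complex 0 \<omega>) - cmat A')" for \<omega>
    unfolding neg(1) by (rule invA)+
  have sf: "transfer A B C D (Complex 0 \<omega>) + transpose (transfer A B C D (- Complex 0 \<omega>))
      = transpose (transfer A B L M (- Complex 0 \<omega>)) ** transfer A B L M (Complex 0 \<omega>)" for \<omega>
    by (rule spectral_factorization[OF assms(7) invA(1) invN(1)])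
  have sf': "transfer A' B' C' D' (Complex 0 \<omega>) + transpose (transfer A' B' C' D' (- Complex 0 \<omega>))
      = transpose (transfer A' B' L' M' (- Complex 0 \<omega>)) ** transfer A' B' L' M' (Complex 0 \<omega>)" for \<omega>
    by (rule spectral_factorization[OF assms(8) invA(2) invN(2)])
  have adj: "transfer A B P Q (- Complex 0 \<omega>) = cnj_mat (transfer A B P Q (Complex 0 \<omega>))"
    for P :: "real^'n^'q" and Q \<omega>
    unfolding neg(2) by (rule transfer_cnj[OF invA(1)])
  have adj': "transfer A' B' P Q (- Complex 0 \<omega>) = cnj_mat (transfer A' B' P Q (Complex 0 \<omega>))"
    for P :: "real^'r^'q" and Q \<omega>
    unfolding neg(2) by (rule transfer_cnj[OF invA(2)])
  \<comment> \<open>The difference of the two products is split by inserting the adjoint of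
    \<open>H\<close> times \<open>H'\<close>. Each summand then has one factor
    \<open>\<Delta>\<close> and one bounded factor, which is why the constant contains the reflected
    \<open>H\<close> and the unreflected \<open>H'\<close>.\<close>
  have id: "E (Complex 0 \<omega>) + transpose (cnj_mat (E (Complex 0 \<omega>)))
      = transpose (H (- Complex 0 \<omega>)) ** \<Delta> (Complex 0 \<omega>)
        + transpose (cnj_mat (\<Delta> (Complex 0 \<omega>))) ** H' (Complex 0 \<omega>)" (is "?l = ?r") for \<omega>
  proof -
    have "?l = (transfer A B C D (Complex 0 \<omega>) + transpose (transfer A B C D (- Complex 0 \<omega>)))
        - (transfer A' B' C' D' (Complex 0 \<omega>) + transpose (transfer A' B' C' D' (- Complex 0 \<omega>)))"
      by (simp add: E_def assms(9,10) adj adj' transpose_diff)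
    also have "\<dots> = ?r"
      unfolding sf sf'
      by (simp add: \<Delta>_def assms(11,12) adj adj' transpose_diff matrix_diff_ldistrib matrix_diff_rdistrib)
    finally show ?thesis .
  qed

  \<comment> \<open>Real values of the two essential suprema\<close>
  obtain a where a: "0 \<le> a" "Linf_imag_norm (\<lambda>s. transpose (H (- s))) = ereal a"
    "AE \<omega> in lborel. spectral_norm (transpose (H (- Complex 0 \<omega>))) \<le> a"
  proof -
    obtain b where b: "\<And>\<omega>. norm (H (Complex 0 \<omega>)) \<le> b"
      using transfer_bounded[OF stab] unfolding assms(11) by blast
    show ?thesis
    proof (rule Linf_imag_norm_finite[of "\<lambda>s. transpose (H (- s))" b, OF _ _ that])
      have "continuous_on UNIV (\<lambda>\<omega>. H (Complex 0 \<omega>))"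
        unfolding assms(11) by (intro continuous_on_line continuous_on_transfer stab) simp
      then have "continuous_on UNIV (\<lambda>\<omega>. H (Complex 0 (- \<omega>)))"
        by (rule continuous_on_compose2) (auto intro!: continuous_intros)
      then show "continuous_on UNIV (\<lambda>\<omega>. transpose (H (- Complex 0 \<omega>)))"
        unfolding neg(1) transpose_def by (intro continuous_on_vec_lambda continuous_on_component)
      show "norm (transpose (H (- Complex 0 \<omega>))) \<le> b" for \<omega>
        unfolding neg(1) norm_transpose by (rule b)
    qed
  qed
  obtain a' where a': "0 \<le> a'" "Linf_imag_norm H' = ereal a'"
    "AE \<omega> in lborel. spectral_norm (H' (Complex 0 \<omega>)) \<le> a'"
  proof -
    obtain b where b: "\<And>\<omega>. norm (H' (Complex 0 \<omega>)) \<le> b"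
      using transfer_bounded[OF stab'] unfolding assms(12) by blast
    show ?thesis
    proof (rule Linf_imag_norm_finite[of H' b, OF _ b that])
      show "continuous_on UNIV (\<lambda>\<omega>. H' (Complex 0 \<omega>))"
        unfolding assms(12) by (intro continuous_on_line continuous_on_transfer stab') simp
    qed
  qed
  \<comment> \<open>The bounded factor is measured in the spectral norm and \<open>\<Delta>\<close>
    in the Frobenius norm, on whichever side each stands.\<close>
  have bound: "AE \<omega> in lborel. (norm (E (Complex 0 \<omega>) + transpose (cnj_mat (E (Complex 0 \<omega>)))))\<^sup>2
      \<le> (a + a')\<^sup>2 * (norm (\<Delta> (Complex 0 \<omega>)))\<^sup>2"
    using a(3) a'(3)
  proof eventually_elim
    case (elim \<omega>)
    let ?d = "norm (\<Delta> (Complex 0 \<omega>))"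
    have "norm (E (Complex 0 \<omega>) + transpose (cnj_mat (E (Complex 0 \<omega>))))
        \<le> spectral_norm (transpose (H (- Complex 0 \<omega>))) * ?d + ?d * spectral_norm (H' (Complex 0 \<omega>))"
      unfolding id
      using norm_matrix_mult_le_left[of "transpose (H (- Complex 0 \<omega>))" "\<Delta> (Complex 0 \<omega>)"]
        norm_matrix_mult_le_right[of "transpose (cnj_mat (\<Delta> (Complex 0 \<omega>)))" "H' (Complex 0 \<omega>)"]
      by (intro norm_triangle_le) (simp add: norm_transpose norm_cnj_mat)
    also have "\<dots> \<le> a * ?d + ?d * a'"
      by (intro add_mono mult_right_mono mult_left_mono elim) auto
    also have "\<dots> = (a + a') * ?d" by (simp add: algebra_simps)
    finally show ?case unfolding power_mult_distrib[symmetric] by (rule power_mono) simp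
  qed

  \<comment> \<open>Equal feedthrough and decay of the error\<close>
  have finE: "H2_norm_sq E < \<infinity>" and fin\<Delta>: "H2_norm_sq \<Delta> < \<infinity>"
    using assms(13,14) unfolding hardy_H2_def E_def \<Delta>_def by auto
  have dec: "stable_decay (\<lambda>s. (E s - (cmat D - cmat D')) $ i $ j)" for i j
    using stable_decay_diff[OF stable_decay_transfer[OF stab, of B C D i j] stable_decay_transfer[OF stab', of B' C' D' i j]]
    by (simp add: E_def assms(9,10) algebra_simps)
  \<comment> \<open>A finite norm of \<open>E\<close> rules out a constant at infinity, so
    \<open>E\<close> itself decays and not only its strictly proper part.\<close>
  have "cmat D - cmat D' = 0"
    by (rule H2_norm_sq_finite_imp_strictly_proper[OF finE dec])
  with dec have dec: "stable_decay (\<lambda>s. E s $ i $ j)" for i j by simp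

  \<comment> \<open>Comparison of the two Hardy norms\<close>
  define N where "N = (\<integral>\<omega>. (norm (E (Complex 0 \<omega>)))\<^sup>2 \<partial>lborel)"
  define h where "h = enn2real (H2_norm_sq \<Delta>)"
  have h: "H2_norm_sq \<Delta> = ennreal h" "0 \<le> h"
    using fin\<Delta> by (simp_all add: h_def)
  have cont\<Delta>: "continuous_on {s. 0 \<le> Re s} \<Delta>"
    unfolding \<Delta>_def assms(11,12) by (intro continuous_intros continuous_on_transfer stab stab')
  then have "continuous_on UNIV (\<lambda>\<omega>. (norm (\<Delta> (Complex 0 \<omega>)))\<^sup>2)"
    by (intro continuous_intros continuous_on_line) simp_all
  then have meas: "(\<lambda>\<omega>. (norm (\<Delta> (Complex 0 \<omega>)))\<^sup>2) \<in> borel_measurable lborel"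
    by (simp add: borel_measurable_continuous_onI)
  \<comment> \<open>The chain runs in \<open>ennreal\<close>, where measurability of the integrand
    in \<open>\<Delta>\<close> is enough and its finite integral comes from \<open>h\<close> at the
    end.\<close>
  have "ennreal (2 * N) = (\<integral>\<^sup>+ \<omega>. ennreal ((norm (E (Complex 0 \<omega>) + transpose (cnj_mat (E (Complex 0 \<omega>)))))\<^sup>2) \<partial>lborel)"
    by (subst nn_integral_eq_integral)
       (auto simp: N_def integral_norm_sq_add_adjoint[OF dec])
  also have "\<dots> \<le> (\<integral>\<^sup>+ \<omega>. ennreal ((a + a')\<^sup>2) * ennreal ((norm (\<Delta> (Complex 0 \<omega>)))\<^sup>2) \<partial>lborel)"
    using bound by (intro nn_integral_mono_AE) (auto simp: ennreal_leI simp flip: ennreal_mult elim!: eventually_mono)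
  also have "\<dots> = ennreal ((a + a')\<^sup>2) * (\<integral>\<^sup>+ \<omega>. ennreal ((norm (\<Delta> (Complex 0 \<omega>)))\<^sup>2) \<partial>lborel)"
    using meas by (intro nn_integral_cmult) simp
  also have "\<dots> \<le> ennreal ((a + a')\<^sup>2) * ennreal h"
    unfolding h(1)[symmetric] by (intro mult_left_mono nn_integral_imag_axis_le_H2_norm_sq[OF cont\<Delta>]) simp
  also have "\<dots> = ennreal ((a + a')\<^sup>2 * h)" using h(2) by (simp add: ennreal_mult)
  finally have "2 * N \<le> (a + a')\<^sup>2 * h"
    using h(2) by (simp add: ennreal_le_iff)
  moreover have "enn2real (H2_norm_sq E) \<le> N"
  proof -
    have "enn2real (H2_norm_sq E) \<le> enn2real (ennreal N)"
      unfolding N_def by (rule enn2real_mono[OF H2_norm_sq_le_imag_axis[OF dec]]) simp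
    also have "\<dots> = N" by (simp add: N_def)
    finally show ?thesis .
  qed
  ultimately have "enn2real (H2_norm_sq E) \<le> (a + a')\<^sup>2 * h / 2" by simp
  then have "H2_norm E \<le> sqrt ((a + a')\<^sup>2 * h / 2)"
    unfolding H2_norm_def by (rule real_sqrt_le_mono)
  \<comment> \<open>Both \<open>a\<close> and \<open>a'\<close> are nonnegative, so the root of the
    square is \<open>a + a'\<close>.\<close>
  also have "\<dots> = 1 / sqrt 2 * (a + a') * H2_norm \<Delta>"
    using a(1) a'(1) by (simp add: H2_norm_def h_def[symmetric] real_sqrt_mult real_sqrt_divide)
  finally have "ereal (H2_norm E) \<le> factor_const H H' * ereal (H2_norm \<Delta>)"
    unfolding factor_const_def a(2) a'(2) by simp
  then show ?thesis by (simp add: E_def \<Delta>_def)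
qed

end
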